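(* Let $\mathcal{F}^k$ be the class of mixtures of $k$ Gaussians in $\mathbb{R}^d$. Then $\mathcal{F}^k$ is $9$-agnostic PAC-learnable with sample complexity $m^9_{\mathcal{F}^k}(\epsilon,\delta)=O(kd^2\log k\log(k/\delta)/\epsilon^4)$. Accordingly, it is also PAC-learnable in the realizable setting with the same number of samples.
   Context: $\mathcal{F}^k=\{\sum_{i=1}^kw_if_i: w_i\ge0,\sum_iw_i=1, f_i \text{ Gaussians } \mathcal{N}_d(\mu_i,\Sigma_i)\}$. $\|f\|_1=\int|f(x)|dx$; $\mathrm{opt}(\mathcal{G},g)=\inf_{f\in\mathcal{G}}\|f-g\|_1$. A $C$-agnostic PAC-learner for $\mathcal{G}$ with sample complexity $m^C_{\mathcal{G}}(\epsilon,\delta)$: for every distribution $g$ and all $\epsilon,\delta>0$, given an i.i.d. sample of size $m^C_{\mathcal{G}}(\epsilon,\delta)$ from $g$, with probability at least $1-\delta$ it outputs $\hat g$ with $\|\hat g-g\|_1\le C\cdot\mathrm{opt}(\mathcal{G},g)+\epsilon$. A realizable PAC-learner requires this only for $g\in\mathcal{G}$, with guarantee $\|\hat g-g\|_1\le\epsilon$. The $O(\cdot)$ hides a universal constant.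
   Formalization: The factors log k and log(k/δ) are read as 1+log k and 1+log(k/δ): for k=1 the literal bound is 0 samples, which cannot suffice; for k≥2 and δ<1 the two bounds agree up to a universal constant. *)

theory Defs
  imports "HOL-Probability.Probability" "HOL-Combinatorics.Permutations"
begin

text \<open>Points of R^d are functions nat => real; only coordinates 0..d-1 matter.
  Lebesgue measure on R^d is the product of d copies of lborel.\<close>

definition Leb :: "nat \<Rightarrow> (nat \<Rightarrow> real) measure" where
  "Leb d = PiM {..<d} (\<lambda>_. lborel)"

definition mdet :: "nat \<Rightarrow> (nat \<Rightarrow> nat \<Rightarrow> real) \<Rightarrow> real" where
  "mdet d A = (\<Sum>p | p permutes {..<d}. of_int (sign p) * (\<Prod>i<d. A i (p i)))"

definition minv :: "nat \<Rightarrow> (nat \<Rightarrow> nat \<Rightarrow> real) \<Rightarrow> (nat \<Rightarrow> nat \<Rightarrow> real)" where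
  "minv d A = (SOME B. \<forall>i<d. \<forall>j<d. (\<Sum>l<d. A i l * B l j) = (if i = j then 1 else 0))"

definition pos_def :: "nat \<Rightarrow> (nat \<Rightarrow> nat \<Rightarrow> real) \<Rightarrow> bool" where
  "pos_def d A \<longleftrightarrow> (\<forall>i<d. \<forall>j<d. A i j = A j i) \<and>
     (\<forall>v. (\<exists>i<d. v i \<noteq> 0) \<longrightarrow> (\<Sum>i<d. \<Sum>j<d. v i * A i j * v j) > 0)"

definition gauss :: "nat \<Rightarrow> (nat \<Rightarrow> real) \<Rightarrow> (nat \<Rightarrow> nat \<Rightarrow> real) \<Rightarrow> (nat \<Rightarrow> real) \<Rightarrow> real" where
  "gauss d \<mu> \<Sigma> x =
     exp (- (1/2) * (\<Sum>i<d. \<Sum>j<d. (x i - \<mu> i) * minv d \<Sigma> i j * (x j - \<mu> j)))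
     / ((2 * pi) powr (real d / 2) * sqrt (mdet d \<Sigma>))"

definition mixtures :: "nat \<Rightarrow> nat \<Rightarrow> ((nat \<Rightarrow> real) \<Rightarrow> real) set" where
  "mixtures d k = {f. \<exists>w \<mu> \<Sigma>. (\<forall>i<k. w i \<ge> (0::real)) \<and> (\<Sum>i<k. w i) = 1 \<and>
      (\<forall>i<k. pos_def d (\<Sigma> i)) \<and> f = (\<lambda>x. \<Sum>i<k. w i * gauss d (\<mu> i) (\<Sigma> i) x)}"

definition L1dist :: "nat \<Rightarrow> ((nat \<Rightarrow> real) \<Rightarrow> real) \<Rightarrow> ((nat \<Rightarrow> real) \<Rightarrow> real) \<Rightarrow> ennreal" where
  "L1dist d f g = (\<integral>\<^sup>+ x. ennreal \<bar>f x - g x\<bar> \<partial>Leb d)"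

definition opt :: "nat \<Rightarrow> ((nat \<Rightarrow> real) \<Rightarrow> real) set \<Rightarrow> ((nat \<Rightarrow> real) \<Rightarrow> real) \<Rightarrow> ennreal" where
  "opt d G g = (INF f\<in>G. L1dist d f g)"

definition is_density :: "nat \<Rightarrow> ((nat \<Rightarrow> real) \<Rightarrow> real) \<Rightarrow> bool" where
  "is_density d g \<longleftrightarrow> g \<in> borel_measurable (Leb d) \<and> (\<forall>x\<in>space (Leb d). g x \<ge> 0) \<and>
     (\<integral>\<^sup>+ x. ennreal (g x) \<partial>Leb d) = 1"

definition sample_space :: "nat \<Rightarrow> nat \<Rightarrow> ((nat \<Rightarrow> real) \<Rightarrow> real) \<Rightarrow> (nat \<Rightarrow> (nat \<Rightarrow> real)) measure" where
  "sample_space d m g = PiM {..<m} (\<lambda>_. density (Leb d) (\<lambda>x. ennreal (g x)))"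

text \<open>Sample size C * k d^2 log k log(k/delta) / eps^4, with log factors read as (1 + log).\<close>

definition sample_size :: "real \<Rightarrow> nat \<Rightarrow> nat \<Rightarrow> real \<Rightarrow> real \<Rightarrow> nat" where
  "sample_size C d k \<epsilon> \<delta> =
     nat \<lceil>C * real k * real d ^ 2 * (1 + ln (real k)) * (1 + ln (real k / \<delta>)) / \<epsilon> ^ 4\<rceil>"

end

theory Submission
  imports Defs "Jordan_Normal_Form.Determinant"
begin

text \<open>
  The learner is a minimum distance estimator over a countable dense set of mixtures, which gives
  the factor 5 directly, with no clustering of the sample. Testing against the Scheffe sets
  f > f' themselves would bring in the VC dimension of sets cut out by sums of exponentials.
  Instead, write f and f' as sums of exponentials of quadratic polynomials and replace the Scheffe set by a
  set that depends on a point only through the comparisons of the differences of any two exponents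
  with finitely many levels. This loses only a small multiple of the integral of f + f'. Each
  comparison is an affine inequality in O(k d^2) parameters, so Sauer's lemma bounds the number of
  traces on a sample, and the number of levels depends on k and epsilon but not on d. Hence no
  factor log d appears in the sample size.
\<close>

section \<open>Sauer's lemma for half-spaces\<close>

text \<open>The obstacle is the number of comparisons per point, of order k^4 / \<epsilon>^2,
  against a sample size nearly linear in k. The growth bound therefore keeps a free parameter y and
  has the form exp (y * number of comparisons) / y ^ p, where p is of order k d^2. With y of order
  \<epsilon>^4 / k^4 the exponential uses up only a fixed fraction of the deviation exponent, and
  the comparisons cost no more than ln (1 / y), the source of the factor log k. This logarithm also
  contains log (1 / \<epsilon>), which is bounded by 1 / \<epsilon>^2; that accounts for two of the
  four powers of \<epsilon>. Candidates are restricted to a countable set because the uniform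
  deviation event is a union over test sets and has to be measurable. Error budget: a slack of
  \<epsilon> / 22, spent on sampling deviation, on approximation by candidates and on inexact
  minimization, enters eleven times and adds up to \<epsilon> / 2. The surrogate sets cost the other
  \<epsilon> / 2, which fixes \<eta> = \<epsilon> / (16 k).\<close>

definition shatters :: "'a set set \<Rightarrow> 'a set \<Rightarrow> bool" where
  "shatters F A \<longleftrightarrow> (\<forall>B\<subseteq>A. \<exists>S\<in>F. S \<inter> A = B)"

lemma shattersD: "shatters F A \<Longrightarrow> B \<subseteq> A \<Longrightarrow> \<exists>S\<in>F. S \<inter> A = B"
  by (simp add: shatters_def)

text \<open>Pajor's form of Sauer's lemma. Delete a point x and split the family into P, the members
  without x, and Q, the members with x after removing x. The cardinalities of the union and the
  intersection of P and Q add up to that of F. What the union shatters is shattered by F and avoids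
  x; what the intersection shatters stays shattered after adding x, since each trace occurs both
  with and without x.\<close>

lemma card_le_shattered:
  assumes "finite X" "F \<subseteq> Pow X"
  shows "card F \<le> card {A\<in>Pow X. shatters F A}"
  using assms
proof (induction X arbitrary: F rule: finite_induct)
  case empty
  then consider "F = {}" | "F = {{}}" by auto
  then show ?case
  proof cases
    case 2
    then have "{A\<in>Pow {}. shatters F A} = {{}}" by (auto simp: shatters_def)
    then show ?thesis using 2 by simp
  qed simp
next
  case (insert x X)
  define P where "P = {S\<in>F. x \<notin> S}"
  define R where "R = {S\<in>F. x \<in> S}"
  define Q where "Q = (\<lambda>S. S - {x}) ` R"
  have finF: "finite F" using insert.prems insert.hyps by (meson finite_Pow_iff finite_insert finite_subset)
  have fin: "finite P" "finite R" "finite Q" using finF by (auto simp: P_def R_def Q_def)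
  have sub: "P \<union> Q \<subseteq> Pow X" "P \<inter> Q \<subseteq> Pow X"
    using insert.prems by (auto simp: P_def Q_def R_def)
  have "F = P \<union> R" "P \<inter> R = {}" by (auto simp: P_def R_def)
  then have "card F = card P + card R" using fin by (simp add: card_Un_disjoint)
  also have "card R = card Q"
    unfolding Q_def by (intro card_image[symmetric] inj_onI) (auto simp: R_def)
  also have "card P + card Q = card (P \<union> Q) + card (P \<inter> Q)"
    using card_Un_Int[OF fin(1,3)] .
  also have "\<dots> \<le> card {A\<in>Pow X. shatters (P \<union> Q) A} + card {A\<in>Pow X. shatters (P \<inter> Q) A}"
    using insert.IH sub by (intro add_mono) auto
  also have "card {A\<in>Pow X. shatters (P \<inter> Q) A} = card (insert x ` {A\<in>Pow X. shatters (P \<inter> Q) A})"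
    using insert.hyps by (intro card_image[symmetric] inj_onI) (metis (lifting) Diff_insert_absorb PowD mem_Collect_eq subsetD)
  also have "card {A\<in>Pow X. shatters (P \<union> Q) A} + \<dots>
      = card ({A\<in>Pow X. shatters (P \<union> Q) A} \<union> insert x ` {A\<in>Pow X. shatters (P \<inter> Q) A})"
    using insert.hyps by (intro card_Un_disjoint[symmetric]) auto
  also have "\<dots> \<le> card {A\<in>Pow (insert x X). shatters F A}"
  proof (intro card_mono Un_least subsetI)
    fix A assume "A \<in> {A\<in>Pow X. shatters (P \<union> Q) A}"
    then have A: "A \<subseteq> X" "shatters (P \<union> Q) A" by auto
    have "\<exists>S\<in>F. S \<inter> A = B" if BA: "B \<subseteq> A" for B
    proof -
      obtain S where S: "S \<in> P \<union> Q" "S \<inter> A = B" using shattersD[OF A(2) BA] by blast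
      have "x \<notin> A" using A insert.hyps by auto
      then show ?thesis using S by (auto simp: P_def Q_def R_def)
    qed
    then have "shatters F A" unfolding shatters_def by (intro allI impI)
    then show "A \<in> {A\<in>Pow (insert x X). shatters F A}" using A by blast
  next
    fix A' assume "A' \<in> insert x ` {A\<in>Pow X. shatters (P \<inter> Q) A}"
    then obtain A where A: "A \<subseteq> X" "shatters (P \<inter> Q) A" "A' = insert x A" by auto
    have xA: "x \<notin> A" using A insert.hyps by auto
    have "\<exists>S\<in>F. S \<inter> A' = B" if BA: "B \<subseteq> A'" for B
    proof -
      obtain S where S: "S \<in> P" "S \<in> Q" "S \<inter> A = B - {x}" 
        using shattersD[OF A(2), of "B - {x}"] BA A(3) by auto
      then obtain S' where S': "S' \<in> F" "x \<in> S'" "S = S' - {x}" by (auto simp: Q_def R_def)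
      have SF: "S \<in> F" "x \<notin> S" using S by (auto simp: P_def)
      show ?thesis
      proof (cases "x \<in> B")
        case True
        then have "S' \<inter> A' = B" using S S' A(3) xA by blast
        then show ?thesis using S' by blast
      next
        case False
        then have "S \<inter> A' = B" using S SF A(3) xA by auto
        then show ?thesis using SF by blast
      qed
    qed
    then have "shatters F A'" unfolding shatters_def by (intro allI impI)
    then show "A' \<in> {A\<in>Pow (insert x X). shatters F A}" using A by blast
  qed (use insert.hyps in auto)
  finally show ?case .
qed

text \<open>Gaussian elimination by induction on the coordinates: a vector that is nonzero at the
  new coordinate clears it from all others, at the cost of one vector and one coordinate.\<close>

lemma exists_linear_dependence:
  fixes u :: "'j \<Rightarrow> 'i \<Rightarrow> real"
  assumes "finite I" "finite J" "card I < card J"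
  shows "\<exists>c. (\<exists>j\<in>J. c j \<noteq> 0) \<and> (\<forall>i\<in>I. (\<Sum>j\<in>J. c j * u j i) = 0)"
  using assms
proof (induction I arbitrary: J u rule: finite_induct)
  case empty
  then have "J \<noteq> {}" by auto
  then show ?case by (intro exI[of _ "\<lambda>_. 1"]) auto
next
  case (insert i I)
  show ?case
  proof (cases "\<forall>j\<in>J. u j i = 0")
    case True
    obtain c where "\<exists>j\<in>J. c j \<noteq> 0" "\<forall>i\<in>I. (\<Sum>j\<in>J. c j * u j i) = 0"
      using insert.IH[of J u] insert.prems insert.hyps by auto
    then show ?thesis using True by (intro exI[of _ c]) auto
  next
    case False
    then obtain j0 where j0: "j0 \<in> J" "u j0 i \<noteq> 0" by auto
    define J' where "J' = J - {j0}"
    define u' where "u' = (\<lambda>j l. u j l - u j i / u j0 i * u j0 l)"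
    have J': "finite J'" "card I < card J'" "J = insert j0 J'" "j0 \<notin> J'"
      using insert.prems insert.hyps j0 by (auto simp: J'_def)
    obtain c where c: "\<exists>j\<in>J'. c j \<noteq> 0" "\<And>l. l \<in> I \<Longrightarrow> (\<Sum>j\<in>J'. c j * u' j l) = 0"
      using insert.IH[OF J'(1,2), of u'] by auto
    \<comment> \<open>This coefficient makes the combination of the original vectors equal to that
      of the reduced ones.\<close>
    define c0 where "c0 = - (\<Sum>j\<in>J'. c j * (u j i / u j0 i))"
    define c' where "c' = c(j0 := c0)"
    have sum: "(\<Sum>j\<in>J. c' j * u j l) = c0 * u j0 l + (\<Sum>j\<in>J'. c j * u j l)" for l
    proof -
      have "(\<Sum>j\<in>J'. c' j * u j l) = (\<Sum>j\<in>J'. c j * u j l)"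
        using J'(4) by (intro sum.cong) (auto simp: c'_def)
      then show ?thesis using J' by (simp add: c'_def)
    qed
    have sum2: "(\<Sum>j\<in>J. c' j * u j l) = (\<Sum>j\<in>J'. c j * u' j l)" for l
      unfolding sum c0_def u'_def
      by (simp add: algebra_simps sum_subtractf sum_distrib_left sum_distrib_right)
    have "u' j i = 0" for j using j0 by (simp add: u'_def)
    then have "(\<Sum>j\<in>J. c' j * u j l) = 0" if "l \<in> insert i I" for l
      using that c(2) unfolding sum2 by auto
    moreover have "\<exists>j\<in>J. c' j \<noteq> 0"
      using c(1) J'(3,4) by (auto simp: c'_def)
    ultimately show ?thesis by blast
  qed
qed

text \<open>If A were larger than I, its vectors would satisfy a linear dependence c. Shattering
  provides a functional that is positive on exactly the points of A where c is positive. Paired with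
  c it gives a positive sum, whereas linearity makes the sum zero.\<close>

lemma shatters_halfspaces_card_le:
  fixes u :: "'j \<Rightarrow> 'i \<Rightarrow> real"
  assumes "finite I" "finite A" "A \<subseteq> J"
    and sh: "shatters ((\<lambda>\<theta>. {j\<in>J. (\<Sum>i\<in>I. \<theta> i * u j i) > 0}) ` \<Theta>) A"
  shows "card A \<le> card I"
proof (rule ccontr)
  assume "\<not> card A \<le> card I"
  then obtain c where c: "\<exists>j\<in>A. c j \<noteq> 0" "\<And>i. i \<in> I \<Longrightarrow> (\<Sum>j\<in>A. c j * u j i) = 0"
    using exists_linear_dependence[of I A u] assms by auto
  have lin: False if pos: "\<exists>j\<in>A. c j > 0" and zero: "\<And>i. i \<in> I \<Longrightarrow> (\<Sum>j\<in>A. c j * u j i) = 0"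
    for c :: "'j \<Rightarrow> real"
  proof -
    have "\<exists>S\<in>(\<lambda>\<theta>. {j\<in>J. (\<Sum>i\<in>I. \<theta> i * u j i) > 0}) ` \<Theta>. S \<inter> A = {j\<in>A. c j > 0}"
      by (rule shattersD[OF sh]) auto
    then obtain \<theta> where \<theta>: "{j\<in>J. (\<Sum>i\<in>I. \<theta> i * u j i) > 0} \<inter> A = {j\<in>A. c j > 0}" by auto
    define s where "s = (\<lambda>j. \<Sum>i\<in>I. \<theta> i * u j i)"
    have s: "s j > 0 \<longleftrightarrow> c j > 0" if "j \<in> A" for j
      using \<theta> that assms(3) by (auto simp: s_def)
    have "0 < (\<Sum>j\<in>A. c j * s j)"
    proof -
      obtain j where j: "j \<in> A" "c j > 0" using pos by auto
      have "0 \<le> c j * s j" if "j \<in> A" for j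
        using s[OF that] by (cases "c j > 0") (auto simp: not_less mult_nonpos_nonpos)
      moreover have "0 < c j * s j" using j s by auto
      ultimately show ?thesis using j assms(2) by (intro sum_pos2[of A j]) auto
    qed
    also have "(\<Sum>j\<in>A. c j * s j) = (\<Sum>j\<in>A. \<Sum>i\<in>I. \<theta> i * (c j * u j i))"
      by (simp add: s_def sum_distrib_left mult_ac)
    also have "\<dots> = (\<Sum>i\<in>I. \<theta> i * (\<Sum>j\<in>A. c j * u j i))"
      by (subst sum.swap) (simp add: sum_distrib_left)
    also have "\<dots> = 0" using zero by simp
    finally show False by simp
  qed
  \<comment> \<open>Strictness needs a positive coefficient, so the sign of c is reversed if
    necessary.\<close>
  obtain j where j: "j \<in> A" "c j \<noteq> 0" using c(1) by auto
  show False
  proof (cases "c j > 0")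
    case True
    then show False using lin[of c] j c(2) by auto
  next
    case False
    then have "- c j > 0" using j by auto
    then show False using lin[of "\<lambda>j. - c j"] j c(2) by (auto simp: sum_negf)
  qed
qed

text \<open>Weighting every subset by x ^ card turns the count into a product, as in a Chernoff
  bound. The usual estimate takes x = p / card J; here x stays free so that it can be matched to the
  deviation exponent.\<close>

lemma card_subsets_le:
  fixes x :: real
  assumes "finite J" "0 < x" "x \<le> 1"
  shows "real (card {A\<in>Pow J. card A \<le> p}) \<le> exp (x * card J) / x ^ p"
proof -
  have "real (card {A\<in>Pow J. card A \<le> p}) * x ^ p = (\<Sum>A | A \<in> Pow J \<and> card A \<le> p. x ^ p)" by simp
  also have "\<dots> \<le> (\<Sum>A | A \<in> Pow J \<and> card A \<le> p. x ^ card A)"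
    using assms by (intro sum_mono power_decreasing) auto
  also have "\<dots> \<le> (\<Sum>A\<in>Pow J. x ^ card A)"
    using assms by (intro sum_mono2) auto
  also have "\<dots> = (\<Prod>j\<in>J. x + 1)"
    using assms by (subst prod_add) auto
  also have "\<dots> = (1 + x) ^ card J" by (simp add: add.commute)
  also have "\<dots> \<le> exp x ^ card J"
    using assms by (intro power_mono exp_ge_add_one_self) auto
  also have "\<dots> = exp (x * card J)" by (simp add: exp_of_nat2_mult)
  finally show ?thesis using assms by (simp add: field_simps)
qed

lemma card_halfspace_patterns_le:
  fixes u :: "'j \<Rightarrow> 'i \<Rightarrow> real" and x :: real
  assumes "finite I" "finite J" "0 < x" "x \<le> 1"
  shows "real (card ((\<lambda>\<theta>. {j\<in>J. (\<Sum>i\<in>I. \<theta> i * u j i) > 0}) ` \<Theta>)) \<le> exp (x * card J) / x ^ card I"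
    (is "real (card ?F) \<le> _")
proof -
  have "card ?F \<le> card {A\<in>Pow J. shatters ?F A}"
    using assms by (intro card_le_shattered) auto
  also have "\<dots> \<le> card {A\<in>Pow J. card A \<le> card I}"
  proof (intro card_mono subsetI)
    fix A assume "A \<in> {A\<in>Pow J. shatters ?F A}"
    then have A: "A \<subseteq> J" "shatters ?F A" by auto
    show "A \<in> {A\<in>Pow J. card A \<le> card I}"
      using shatters_halfspaces_card_le[OF assms(1) finite_subset[OF A(1) assms(2)] A] A by blast
  qed (use assms in auto)
  finally show ?thesis using card_subsets_le[OF assms(2-4), of "card I"] by linarith
qed

section \<open>The Vapnik-Chervonenkis inequality\<close>

text \<open>This is cosh x <= exp (x^2 / 2). Two monotonicity arguments give it: y - tanh y has
  derivative tanh^2, and x^2 / 2 - ln (cosh x) has derivative x - tanh x.\<close>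

lemma exp_plus_exp_minus_le: "exp x + exp (- x) \<le> 2 * exp (x\<^sup>2 / 2)" for x :: real
proof -
  have tanh: "tanh y \<le> y" if "y \<ge> 0" for y :: real
  proof -
    have "(\<lambda>y. y - tanh y) 0 \<le> (\<lambda>y. y - tanh y) y"
    proof (rule DERIV_nonneg_imp_nondecreasing[OF that])
      fix x :: real
      have "((\<lambda>y. y - tanh y) has_real_derivative (tanh x)\<^sup>2) (at x)"
        by (rule derivative_eq_intros refl | simp add: cosh_real_nonzero)+
      then show "\<exists>z. ((\<lambda>y. y - tanh y) has_real_derivative z) (at x) \<and> 0 \<le> z"
        by (intro exI[of _ "(tanh x)\<^sup>2"]) simp
    qed
    then show ?thesis by simp
  qed
  have cosh: "cosh y \<le> exp (y\<^sup>2 / 2)" if "y \<ge> 0" for y :: real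
  proof -
    have "(\<lambda>y. y\<^sup>2 / 2 - ln (cosh y)) 0 \<le> (\<lambda>y. y\<^sup>2 / 2 - ln (cosh y)) y"
    proof (rule DERIV_nonneg_imp_nondecreasing[OF that])
      fix x :: real assume x: "0 \<le> x"
      have "((\<lambda>y. y\<^sup>2 / 2 - ln (cosh y)) has_real_derivative (x - tanh x)) (at x)"
        by (rule derivative_eq_intros refl | simp add: cosh_real_pos tanh_def)+
      then show "\<exists>z. ((\<lambda>y. y\<^sup>2 / 2 - ln (cosh y)) has_real_derivative z) (at x) \<and> 0 \<le> z"
        using tanh[OF x] by (intro exI[of _ "x - tanh x"]) simp
    qed
    then have "ln (cosh y) \<le> y\<^sup>2 / 2" by simp
    then show ?thesis by (metis cosh_real_pos exp_le_cancel_iff exp_ln)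
  qed
  have "cosh x \<le> exp (x\<^sup>2 / 2)"
    using cosh[of x] cosh[of "- x"] by (cases "x \<ge> 0") auto
  then show ?thesis by (simp add: cosh_def)
qed

text \<open>Sign vectors are encoded by the set of positions with sign -1, so that a Rademacher
  average is a finite sum over \<open>Pow I\<close> and T can double as the set of swapped pairs of
  a double sample.\<close>

definition flip_sign :: "'a set \<Rightarrow> 'a \<Rightarrow> real" where
  "flip_sign T i = (if i \<in> T then - 1 else 1)"

text \<open>Independence of the signs becomes the expansion \<open>prod_add\<close>: the sum over
  sign vectors factors into terms 2 cosh (s a_i), each at most 2 exp (s^2 / 2).\<close>

lemma rademacher_mgf_le:
  fixes a :: "'i \<Rightarrow> real" and s :: real
  assumes "finite I" "\<And>i. i \<in> I \<Longrightarrow> \<bar>a i\<bar> \<le> 1"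
  shows "(\<Sum>T\<in>Pow I. exp (s * (\<Sum>i\<in>I. flip_sign T i * a i))) \<le> 2 ^ card I * exp (card I * s\<^sup>2 / 2)"
proof -
  have "(\<Sum>T\<in>Pow I. exp (s * (\<Sum>i\<in>I. flip_sign T i * a i)))
      = (\<Sum>T\<in>Pow I. (\<Prod>i\<in>T. exp (- (s * a i))) * (\<Prod>i\<in>I - T. exp (s * a i)))"
  proof (intro sum.cong refl)
    fix T assume "T \<in> Pow I"
    then have T: "T \<subseteq> I" "finite T" using assms(1) by (auto intro: finite_subset)
    have "exp (s * (\<Sum>i\<in>I. flip_sign T i * a i)) = (\<Prod>i\<in>I. exp (s * (flip_sign T i * a i)))"
      by (simp add: exp_sum assms(1) sum_distrib_left)
    also have "\<dots> = (\<Prod>i\<in>I - T. exp (s * (flip_sign T i * a i))) * (\<Prod>i\<in>T. exp (s * (flip_sign T i * a i)))"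
      using T assms(1) by (intro prod.subset_diff) auto
    also have "\<dots> = (\<Prod>i\<in>I - T. exp (s * a i)) * (\<Prod>i\<in>T. exp (- (s * a i)))"
      by (intro arg_cong2[of _ _ _ _ "(*)"] prod.cong) (auto simp: flip_sign_def)
    finally show "exp (s * (\<Sum>i\<in>I. flip_sign T i * a i))
        = (\<Prod>i\<in>T. exp (- (s * a i))) * (\<Prod>i\<in>I - T. exp (s * a i))" by simp
  qed
  also have "\<dots> = (\<Prod>i\<in>I. exp (- (s * a i)) + exp (s * a i))"
    by (rule prod_add[OF assms(1), symmetric])
  also have "\<dots> \<le> (\<Prod>i\<in>I. 2 * exp (s\<^sup>2 / 2))"
  proof (intro prod_mono conjI)
    fix i assume i: "i \<in> I"
    have "exp (- (s * a i)) + exp (s * a i) \<le> 2 * exp ((s * a i)\<^sup>2 / 2)"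
      using exp_plus_exp_minus_le[of "s * a i"] by simp
    also have "(s * a i)\<^sup>2 \<le> s\<^sup>2"
      using assms(2)[OF i] by (simp add: power_mult_distrib mult_left_le abs_square_le_1)
    finally show "exp (- (s * a i)) + exp (s * a i) \<le> 2 * exp (s\<^sup>2 / 2)" by simp
  qed (simp add: add_nonneg_nonneg)
  also have "\<dots> = 2 ^ card I * exp (card I * s\<^sup>2 / 2)"
    by (simp add: power_mult_distrib exp_of_nat_mult[symmetric])
  finally show ?thesis .
qed

lemma rademacher_tail_le:
  fixes a :: "'i \<Rightarrow> real"
  assumes I: "finite I" "I \<noteq> {}" and a: "\<And>i. i \<in> I \<Longrightarrow> \<bar>a i\<bar> \<le> 1" and t: "t \<ge> 0"
  shows "real (card {T\<in>Pow I. \<bar>\<Sum>i\<in>I. flip_sign T i * a i\<bar> > t})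
    \<le> 2 ^ card I * (2 * exp (- (t\<^sup>2 / (2 * card I))))"
proof -
  define n where "n = real (card I)"
  have n: "n > 0" using I by (simp add: n_def card_gt_0_iff)
  have one: "real (card {T\<in>Pow I. (\<Sum>i\<in>I. flip_sign T i * a i) > t}) \<le> 2 ^ card I * exp (- (t\<^sup>2 / (2 * n)))"
    if a: "\<And>i. i \<in> I \<Longrightarrow> \<bar>a i\<bar> \<le> 1" for a :: "'i \<Rightarrow> real"
  proof -
    define s where "s = (\<lambda>T. \<Sum>i\<in>I. flip_sign T i * a i)"
    have "real (card {T\<in>Pow I. s T > t}) = (\<Sum>T | T \<in> Pow I \<and> s T > t. 1)" by simp
    \<comment> \<open>The multiplier t / n is the s that minimizes n s^2 / 2 - s t.\<close>
    also have "\<dots> \<le> (\<Sum>T | T \<in> Pow I \<and> s T > t. exp (t / n * (s T - t)))"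
      using t n by (intro sum_mono) auto
    also have "\<dots> \<le> (\<Sum>T\<in>Pow I. exp (t / n * (s T - t)))"
      using I by (intro sum_mono2) auto
    also have "\<dots> = (\<Sum>T\<in>Pow I. exp (t / n * s T)) * exp (- (t\<^sup>2 / n))"
      unfolding sum_distrib_right mult_exp_exp
      by (intro sum.cong refl arg_cong[where f = exp]) (simp add: algebra_simps power2_eq_square)
    also have "\<dots> \<le> (2 ^ card I * exp (n * (t / n)\<^sup>2 / 2)) * exp (- (t\<^sup>2 / n))"
      unfolding s_def n_def by (intro mult_right_mono rademacher_mgf_le[OF I(1) a, where s = "t / real (card I)"]) auto
    also have "\<dots> = 2 ^ card I * exp (n * (t / n)\<^sup>2 / 2 - t\<^sup>2 / n)"
      by (simp add: exp_diff exp_minus field_simps)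
    also have "n * (t / n)\<^sup>2 / 2 - t\<^sup>2 / n = - (t\<^sup>2 / (2 * n))"
      using n by (simp add: power2_eq_square field_simps)
    finally show ?thesis unfolding s_def .
  qed
  have "{T\<in>Pow I. \<bar>\<Sum>i\<in>I. flip_sign T i * a i\<bar> > t} =
      {T\<in>Pow I. (\<Sum>i\<in>I. flip_sign T i * a i) > t} \<union> {T\<in>Pow I. (\<Sum>i\<in>I. flip_sign T i * - a i) > t}"
    by (auto simp: sum_negf)
  then have "card {T\<in>Pow I. \<bar>\<Sum>i\<in>I. flip_sign T i * a i\<bar> > t} \<le>
      card {T\<in>Pow I. (\<Sum>i\<in>I. flip_sign T i * a i) > t} + card {T\<in>Pow I. (\<Sum>i\<in>I. flip_sign T i * - a i) > t}"
    by (simp add: card_Un_le)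
  then show ?thesis using one[of a] one[of "\<lambda>i. - a i"] a by (simp add: n_def)
qed

section \<open>Concentration for a single set, and exchangeability of a sample\<close>

lemma (in prob_space) PiM_frequency_deviation_le:
  assumes J: "finite J" "J \<noteq> {}" and B: "B \<in> sets M" and t: "t \<ge> 0"
  shows "measure (PiM J (\<lambda>_. M)) {y\<in>space (PiM J (\<lambda>_. M)).
      \<bar>(\<Sum>j\<in>J. indicator B (y j)) - card J * prob B\<bar> \<ge> t} \<le> 2 * exp (- 2 * t\<^sup>2 / card J)"
proof -
  let ?N = "PiM J (\<lambda>_. M)"
  interpret N: prob_space ?N by (intro prob_space_PiM prob_space_axioms)
  have comp: "distr ?N M (\<lambda>y. y j) = M" if "j \<in> J" for j
    by (rule distr_PiM_component[of J "\<lambda>_. M"]) (use that prob_space_axioms in auto)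
  \<comment> \<open>Independence is read off from the joint law: it is the product of its own
    marginals.\<close>
  have "N.indep_vars (\<lambda>_. M) (\<lambda>j y. y j) J"
  proof (subst N.indep_vars_iff_distr_eq_PiM')
    have "distr ?N ?N (\<lambda>y. \<lambda>j\<in>J. y j) = distr ?N ?N (\<lambda>y. y)"
      by (intro distr_cong) (auto simp: space_PiM)
    also have "\<dots> = PiM J (\<lambda>j. distr ?N M (\<lambda>y. y j))"
      using comp by (simp add: distr_id cong: PiM_cong)
    finally show "distr ?N ?N (\<lambda>y. \<lambda>j\<in>J. y j) = PiM J (\<lambda>j. distr ?N M (\<lambda>y. y j))" .
  qed (use J in auto)
  then have ind: "N.indep_vars (\<lambda>_. borel) (\<lambda>j y. indicator B (y j) :: real) J"
    using B by (intro N.indep_vars_compose2[where X = "\<lambda>j y. y j" and Y = "\<lambda>_ x. indicator B x :: real"]) auto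
  obtain j0 where j0: "j0 \<in> J" using J by auto
  have mf[measurable]: "(\<lambda>x. indicator B x :: real) \<in> borel_measurable M" using B by simp
  have d: "distr ?N borel (\<lambda>y. indicator B (y j) :: real) = distr M borel (indicator B)" if "j \<in> J" for j
    using that B by (subst comp[OF that, symmetric], subst distr_distr) (auto simp: comp_def)
  have expt: "N.expectation (\<lambda>y. indicator B (y j0) :: real) = prob B"
  proof -
    have "N.expectation (\<lambda>y. indicator B (y j0) :: real) = integral\<^sup>L (distr ?N M (\<lambda>y. y j0)) (indicator B)"
      using j0 by (subst integral_distr) auto
    also have "\<dots> = prob B" using B by (simp add: comp[OF j0])
    finally show ?thesis .
  qed
  interpret H: Hoeffding_ineq_iid ?N J "\<lambda>j y. indicator B (y j) :: real" "\<lambda>y. indicator B (y j0)" 0 1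
    "N.expectation (\<lambda>y. indicator B (y j0) :: real)"
    using J ind B d j0 by unfold_locales (auto intro!: measurable_compose[OF measurable_component_singleton])
  show ?thesis
    using H.Hoeffding_ineq_abs_ge[OF t _ J(2)] by (simp add: expt)
qed

text \<open>The product of the transpositions of i and i + n over i in T. Acting on a double sample,
  it multiplies the i-th difference of indicators by \<open>flip_sign T i\<close>.\<close>

definition swap_index :: "nat \<Rightarrow> nat set \<Rightarrow> nat \<Rightarrow> nat" where
  "swap_index n T i = (if i < n then if i \<in> T then i + n else i else if i - n \<in> T then i - n else i)"

lemma swap_index_lt: "T \<subseteq> {..<n} \<Longrightarrow> i < 2 * n \<Longrightarrow> swap_index n T i < 2 * n"
  by (auto simp: swap_index_def)

lemma swap_index_involution: "T \<subseteq> {..<n} \<Longrightarrow> i < 2 * n \<Longrightarrow> swap_index n T (swap_index n T i) = i"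
  by (auto simp: swap_index_def)

lemma (in prob_space) distr_swap_index:
  assumes "T \<subseteq> {..<n}"
  defines "N \<equiv> PiM {..<2 * n} (\<lambda>_. M)"
  shows "distr N N (\<lambda>z. \<lambda>i\<in>{..<2 * n}. z (swap_index n T i)) = N"
  unfolding N_def
proof (rule distr_PiM_reindex[of "{..<2 * n}" "\<lambda>_. M" "swap_index n T"])
  show "inj_on (swap_index n T) {..<2 * n}"
    by (rule inj_on_inverseI[of _ "swap_index n T"]) (use swap_index_involution assms in auto)
qed (use swap_index_lt assms prob_space_axioms in auto)


text \<open>By exchangeability the event can be averaged over all 2 ^ n ways of swapping z i with z
  (i + n). For a fixed double sample a swap only changes signs, and sets with the same trace give
  the same signed sum, so a union bound over at most G traces replaces one over the whole
  family.\<close>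

lemma (in prob_space) emeasure_symmetrized_deviation_le:
  fixes \<B> :: "'a set set" and n :: nat
  assumes cnt: "countable \<B>" and sets: "\<B> \<subseteq> sets M" and n: "n > 0" and t: "t \<ge> 0"
    and growth: "\<And>z. z \<in> {..<2 * n} \<rightarrow> space M \<Longrightarrow> real (card ((\<lambda>B. {i\<in>{..<2 * n}. z i \<in> B}) ` \<B>)) \<le> G"
  shows "emeasure (PiM {..<2 * n} (\<lambda>_. M)) {z\<in>space (PiM {..<2 * n} (\<lambda>_. M)).
      \<exists>B\<in>\<B>. \<bar>(\<Sum>i<n. indicator B (z i)) - (\<Sum>i<n. indicator B (z (i + n)))\<bar> > t}
    \<le> ennreal (2 * G * exp (- (t\<^sup>2 / (2 * n))))"
proof -
  define N where "N = PiM {..<2 * n} (\<lambda>_. M)"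
  interpret N: prob_space N unfolding N_def by (intro prob_space_PiM prob_space_axioms)
  define D where "D = {z\<in>space N. \<exists>B\<in>\<B>. \<bar>(\<Sum>i<n. indicator B (z i)) - (\<Sum>i<n. indicator B (z (i + n)))\<bar> > t}"
  define w where "w = (\<lambda>T z. \<lambda>i\<in>{..<2 * n}. (z :: nat \<Rightarrow> 'a) (swap_index n T i))"
  define e where "e = 2 * exp (- (t\<^sup>2 / (2 * n)))"
  have e: "e \<ge> 0" by (simp add: e_def)
  have comp[measurable]: "(\<lambda>z. indicator B (z i) :: real) \<in> borel_measurable N" if "B \<in> \<B>" "i < 2 * n" for B i
    using that sets unfolding N_def
    by (intro measurable_compose[OF measurable_component_singleton[of i]] borel_measurable_indicator) auto
  have Dset[measurable]: "D \<in> sets N"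
  proof -
    have "D = (\<Union>B\<in>\<B>. {z\<in>space N. \<bar>(\<Sum>i<n. indicator B (z i)) - (\<Sum>i<n. indicator B (z (i + n)))\<bar> > t})"
      by (auto simp: D_def)
    also have "\<dots> \<in> sets N"
    proof (intro sets.countable_UN'' cnt)
      fix B assume B: "B \<in> \<B>"
      have [measurable]: "(\<lambda>z. (\<Sum>i<n. indicator B (z i)) - (\<Sum>i<n. indicator B (z (i + n))) :: real) \<in> borel_measurable N"
        using comp[OF B] by (intro borel_measurable_diff borel_measurable_sum) auto
      show "{z\<in>space N. \<bar>(\<Sum>i<n. indicator B (z i)) - (\<Sum>i<n. indicator B (z (i + n)))\<bar> > t} \<in> sets N"
        by measurable
    qed
    finally show ?thesis .
  qed
  have wm: "w T \<in> measurable N N" if "T \<subseteq> {..<n}" for T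
    unfolding w_def N_def using swap_index_lt[OF that]
    by (intro measurable_restrict measurable_component_singleton) auto
  have inv: "emeasure N D = (\<integral>\<^sup>+ z. indicator D (w T z) \<partial>N)" if T: "T \<in> Pow {..<n}" for T
  proof -
    have "emeasure N D = emeasure (distr N N (w T)) D"
      using distr_swap_index[of T n] T by (simp add: w_def N_def)
    also have "\<dots> = (\<integral>\<^sup>+ z. indicator D z \<partial>distr N N (w T))" by simp
    also have "\<dots> = (\<integral>\<^sup>+ z. indicator D (w T z) \<partial>N)"
      using wm T by (intro nn_integral_distr) auto
    finally show ?thesis .
  qed
  have pt: "(\<Sum>T\<in>Pow {..<n}. indicator D (w T z)) \<le> ennreal (2 ^ n * (G * e))" if z: "z \<in> space N" for z
  proof -
    have z': "z \<in> {..<2 * n} \<rightarrow> space M" using z by (auto simp: N_def space_PiM)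
    define \<A> where "\<A> = (\<lambda>B. {i\<in>{..<2 * n}. z i \<in> B}) ` \<B>"
    have finA: "finite \<A>" by (rule finite_subset[of _ "Pow {..<2 * n}"]) (auto simp: \<A>_def)
    define a where "a = (\<lambda>A i. indicator A i - indicator A (i + n) :: real)"
    have "{T\<in>Pow {..<n}. w T z \<in> D} \<subseteq> (\<Union>A\<in>\<A>. {T\<in>Pow {..<n}. \<bar>\<Sum>i<n. flip_sign T i * a A i\<bar> > t})"
    proof
      fix T assume "T \<in> {T\<in>Pow {..<n}. w T z \<in> D}"
      then obtain B where T: "T \<subseteq> {..<n}" and B: "B \<in> \<B>"
        "\<bar>(\<Sum>i<n. indicator B (w T z i)) - (\<Sum>i<n. indicator B (w T z (i + n)) :: real)\<bar> > t"
        by (auto simp: D_def)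
      define A where "A = {i\<in>{..<2 * n}. z i \<in> B}"
      have "(\<Sum>i<n. indicator B (w T z i)) - (\<Sum>i<n. indicator B (w T z (i + n)) :: real)
          = (\<Sum>i<n. indicator B (w T z i) - indicator B (w T z (i + n)))"
        by (simp add: sum_subtractf)
      \<comment> \<open>Swapping the pair i exchanges its two indicators and thus negates their
        difference.\<close>
      also have "\<dots> = (\<Sum>i<n. flip_sign T i * a A i)"
        by (intro sum.cong refl)
          (auto simp: w_def swap_index_def flip_sign_def a_def A_def indicator_def)
      finally have "\<bar>\<Sum>i<n. flip_sign T i * a A i\<bar> > t" using B by simp
      then show "T \<in> (\<Union>A\<in>\<A>. {T\<in>Pow {..<n}. \<bar>\<Sum>i<n. flip_sign T i * a A i\<bar> > t})"
        using T B by (auto simp: \<A>_def A_def)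
    qed
    then have "card {T\<in>Pow {..<n}. w T z \<in> D} \<le> card (\<Union>A\<in>\<A>. {T\<in>Pow {..<n}. \<bar>\<Sum>i<n. flip_sign T i * a A i\<bar> > t})"
      using finA by (intro card_mono) auto
    also have "\<dots> \<le> (\<Sum>A\<in>\<A>. card {T\<in>Pow {..<n}. \<bar>\<Sum>i<n. flip_sign T i * a A i\<bar> > t})"
      by (rule card_UN_le[OF finA])
    finally have "real (card {T\<in>Pow {..<n}. w T z \<in> D})
        \<le> (\<Sum>A\<in>\<A>. real (card {T\<in>Pow {..<n}. \<bar>\<Sum>i<n. flip_sign T i * a A i\<bar> > t}))"
      by (simp flip: of_nat_sum)
    also have "\<dots> \<le> (\<Sum>A\<in>\<A>. 2 ^ n * e)"
    proof (intro sum_mono)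
      fix A
      show "real (card {T\<in>Pow {..<n}. \<bar>\<Sum>i<n. flip_sign T i * a A i\<bar> > t}) \<le> 2 ^ n * e"
        using rademacher_tail_le[of "{..<n}" "a A" t] n t
        by (simp add: e_def a_def lessThan_empty_iff indicator_def of_bool_def)
    qed
    also have "\<dots> \<le> 2 ^ n * (G * e)"
      using mult_right_mono[OF growth[OF z'], of "2 ^ n * e"] e by (simp add: \<A>_def mult_ac)
    finally have "real (card {T\<in>Pow {..<n}. w T z \<in> D}) \<le> 2 ^ n * (G * e)" .
    moreover have "(\<Sum>T\<in>Pow {..<n}. indicator D (w T z)) = ennreal (real (card {T\<in>Pow {..<n}. w T z \<in> D}))"
    proof -
      have "(\<Sum>T\<in>Pow {..<n}. indicator D (w T z) :: ennreal) = (\<Sum>T | T \<in> Pow {..<n} \<and> w T z \<in> D. 1)"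
        by (intro sum.mono_neutral_cong_right) (auto simp: indicator_def)
      then show ?thesis by (simp add: ennreal_of_nat_eq_real_of_nat)
    qed
    ultimately show ?thesis by (simp add: ennreal_leI)
  qed
  \<comment> \<open>All 2 ^ n swapped copies of D have the measure of D, so the pointwise count of
    swaps can be integrated.\<close>
  have "2 ^ n * emeasure N D = (\<Sum>T\<in>Pow {..<n}. emeasure N D)"
    by (simp add: card_Pow)
  also have "\<dots> = (\<Sum>T\<in>Pow {..<n}. \<integral>\<^sup>+ z. indicator D (w T z) \<partial>N)"
    by (intro sum.cong refl inv)
  also have "\<dots> = (\<integral>\<^sup>+ z. (\<Sum>T\<in>Pow {..<n}. indicator D (w T z)) \<partial>N)"
    using wm by (intro nn_integral_sum[symmetric] measurable_compose[OF wm borel_measurable_indicator]) auto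
  also have "\<dots> \<le> (\<integral>\<^sup>+ z. ennreal (2 ^ n * (G * e)) \<partial>N)"
    by (intro nn_integral_mono pt)
  also have "\<dots> = 2 ^ n * ennreal (G * e)"
    by (simp add: N.emeasure_space_1 ennreal_mult' ennreal_power[symmetric])
  finally have "emeasure N D \<le> ennreal (G * e)"
    by (subst (asm) ennreal_mult_le_mult_iff) (auto simp: power_eq_top_ennreal)
  then show ?thesis by (simp add: D_def N_def e_def mult_ac)
qed

text \<open>A ghost sample replaces the unknown probability. If the count of B is off by more than n
  \<epsilon> on the first half, the ghost count is within n \<epsilon> / 2 of its mean with
  probability at least 1/2, and then the two counts differ by more than n \<epsilon> / 2. Hence the
  bad event has at most twice the probability of the symmetrized one.\<close>

theorem (in prob_space) vc_uniform_deviation: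
  fixes \<B> :: "'a set set" and \<epsilon> :: real
  assumes cnt: "countable \<B>" and sets: "\<B> \<subseteq> sets M" and n: "n > 0" and \<epsilon>: "\<epsilon> > 0" and large: "real n * \<epsilon>\<^sup>2 \<ge> 4"
    and growth: "\<And>z. z \<in> {..<2 * n} \<rightarrow> space M \<Longrightarrow> real (card ((\<lambda>B. {i\<in>{..<2 * n}. z i \<in> B}) ` \<B>)) \<le> G"
  shows "measure (PiM {..<n} (\<lambda>_. M)) {z\<in>space (PiM {..<n} (\<lambda>_. M)).
      \<exists>B\<in>\<B>. \<bar>(\<Sum>i<n. indicator B (z i)) - n * prob B\<bar> > n * \<epsilon>} \<le> 4 * G * exp (- (n * \<epsilon>\<^sup>2 / 8))"
proof -
  define I where "I = {..<n}"
  define J where "J = {n..<2 * n}"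
  define MI where "MI = PiM I (\<lambda>_. M)"
  define MJ where "MJ = PiM J (\<lambda>_. M)"
  define N where "N = PiM {..<2 * n} (\<lambda>_. M)"
  define t where "t = n * \<epsilon> / 2"
  interpret MI: prob_space MI unfolding MI_def by (intro prob_space_PiM prob_space_axioms)
  interpret MJ: prob_space MJ unfolding MJ_def by (intro prob_space_PiM prob_space_axioms)
  interpret prod: product_sigma_finite "\<lambda>_::nat. M" ..
  have IJ: "I \<union> J = {..<2 * n}" "I \<inter> J = {}" "finite I" "finite J" "card J = n" "J \<noteq> {}"
    using n by (auto simp: I_def J_def)
  define bad where "bad = {z\<in>space MI. \<exists>B\<in>\<B>. \<bar>(\<Sum>i<n. indicator B (z i)) - n * prob B\<bar> > n * \<epsilon>}"
  define D where "D = {z\<in>space N. \<exists>B\<in>\<B>. \<bar>(\<Sum>i<n. indicator B (z i)) - (\<Sum>i<n. indicator B (z (i + n)))\<bar> > t}"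
  have G: "G \<ge> 0"
  proof -
    obtain x where "x \<in> space M" using not_empty by auto
    then show ?thesis using growth[of "\<lambda>_. x"] by (intro order.trans[OF _ growth[of "\<lambda>_. x"]]) auto
  qed
  \<comment> \<open>Countability of the family makes the existential quantifier a countable union of
    measurable sets.\<close>
  have badset[measurable]: "bad \<in> sets MI"
  proof -
    have "bad = (\<Union>B\<in>\<B>. {z\<in>space MI. \<bar>(\<Sum>i<n. indicator B (z i)) - n * prob B\<bar> > n * \<epsilon>})"
      by (auto simp: bad_def)
    also have "\<dots> \<in> sets MI"
    proof (intro sets.countable_UN'' cnt)
      fix B assume B: "B \<in> \<B>"
      have [measurable]: "(\<lambda>z. (\<Sum>i<n. indicator B (z i)) :: real) \<in> borel_measurable MI"
        using B sets unfolding MI_def I_def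
        by (intro borel_measurable_sum measurable_compose[OF measurable_component_singleton] borel_measurable_indicator) auto
      show "{z\<in>space MI. \<bar>(\<Sum>i<n. indicator B (z i)) - n * prob B\<bar> > n * \<epsilon>} \<in> sets MI"
        by measurable
    qed
    finally show ?thesis .
  qed
  have Dset[measurable]: "D \<in> sets N"
  proof -
    have "D = (\<Union>B\<in>\<B>. {z\<in>space N. \<bar>(\<Sum>i<n. indicator B (z i)) - (\<Sum>i<n. indicator B (z (i + n)))\<bar> > t})"
      by (auto simp: D_def)
    also have "\<dots> \<in> sets N"
    proof (intro sets.countable_UN'' cnt)
      fix B assume B: "B \<in> \<B>"
      have [measurable]: "(\<lambda>z. (\<Sum>i<n. indicator B (z i)) - (\<Sum>i<n. indicator B (z (i + n))) :: real) \<in> borel_measurable N"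
        using B sets unfolding N_def
        by (intro borel_measurable_diff borel_measurable_sum measurable_compose[OF measurable_component_singleton] borel_measurable_indicator) auto
      show "{z\<in>space N. \<bar>(\<Sum>i<n. indicator B (z i)) - (\<Sum>i<n. indicator B (z (i + n)))\<bar> > t} \<in> sets N"
        by measurable
    qed
    finally show ?thesis .
  qed
  have half: "ennreal (1 / 2) \<le> (\<integral>\<^sup>+ y. indicator D (merge I J (x, y)) \<partial>MJ)" if x: "x \<in> bad" for x
  proof -
    obtain B where B: "B \<in> \<B>" "\<bar>(\<Sum>i<n. indicator B (x i)) - n * prob B\<bar> > n * \<epsilon>"
      using x by (auto simp: bad_def)
    have xs: "x \<in> space MI" using x by (auto simp: bad_def)
    have BM[measurable]: "B \<in> sets M" using B sets by auto
    define far where "far = {y\<in>space MJ. \<bar>(\<Sum>j\<in>J. indicator B (y j)) - n * prob B\<bar> \<ge> t}"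
    have [measurable]: "(\<lambda>z. (\<Sum>j\<in>J. indicator B (z j)) :: real) \<in> borel_measurable MJ"
      unfolding MJ_def
      by (intro borel_measurable_sum measurable_compose[OF measurable_component_singleton] borel_measurable_indicator) auto
    have far[measurable]: "far \<in> sets MJ" unfolding far_def by measurable
    have "MJ.prob far \<le> 2 * exp (- 2 * t\<^sup>2 / n)"
      using PiM_frequency_deviation_le[of J B t] IJ BM \<epsilon> by (simp add: far_def MJ_def t_def)
    \<comment> \<open>Here 2 t^2 / n = n \<epsilon>^2 / 2, which is at least 2 by
      \<open>large\<close>. The next bound uses exp 1 >= 2.\<close>
    also have "\<dots> \<le> 2 * exp (- 2)"
      using large n by (simp add: t_def power2_eq_square field_simps)
    also have "\<dots> \<le> 1 / 2"
      using exp_ge_add_one_self[of 1] power_mono[OF exp_ge_add_one_self[of "1::real"], of 2]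
      by (simp add: exp_minus field_simps power2_eq_square mult_exp_exp)
    finally have "1 / 2 \<le> MJ.prob (space MJ - far)"
      by (simp add: MJ.prob_compl)
    then have "ennreal (1 / 2) \<le> emeasure MJ (space MJ - far)"
      unfolding MJ.emeasure_eq_measure by (rule ennreal_leI)
    also have "\<dots> = (\<integral>\<^sup>+ y. indicator (space MJ - far) y \<partial>MJ)" by simp
    also have "\<dots> \<le> (\<integral>\<^sup>+ y. indicator D (merge I J (x, y)) \<partial>MJ)"
    proof (intro nn_integral_mono)
      fix y assume y: "y \<in> space MJ"
      have "merge I J (x, y) \<in> D" if "y \<notin> far"
      proof -
        have c: "\<bar>(\<Sum>j\<in>J. indicator B (y j)) - n * prob B\<bar> < t" using that y by (auto simp: far_def)
        have sp: "merge I J (x, y) \<in> space N"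
          using xs y IJ(1,2) unfolding N_def MI_def MJ_def
          by (auto simp: space_PiM PiE_iff merge_def extensional_def)
        have s1: "(\<Sum>i<n. indicator B (merge I J (x, y) i)) = (\<Sum>i<n. indicator B (x i) :: real)"
          by (intro sum.cong) (auto simp: merge_def I_def)
        have "(\<Sum>i<n. indicator B (merge I J (x, y) (i + n))) = (\<Sum>i<n. indicator B (y (i + n)) :: real)"
          by (intro sum.cong) (auto simp: merge_def I_def J_def)
        also have "\<dots> = (\<Sum>j\<in>J. indicator B (y j))"
          unfolding J_def by (rule sum.reindex_bij_witness[of _ "\<lambda>j. j - n" "\<lambda>i. i + n"]) auto
        finally have s2: "(\<Sum>i<n. indicator B (merge I J (x, y) (i + n))) = (\<Sum>j\<in>J. indicator B (y j) :: real)" .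
        have "t < \<bar>(\<Sum>i<n. indicator B (x i)) - (\<Sum>j\<in>J. indicator B (y j) :: real)\<bar>"
          using c B(2) unfolding t_def by linarith
        then show ?thesis unfolding D_def using sp B(1)
          by (intro CollectI conjI bexI[of _ B]) (simp_all only: s1 s2)
      qed
      then show "indicator (space MJ - far) y \<le> (indicator D (merge I J (x, y)) :: ennreal)"
        by (auto simp: indicator_def)
    qed
    finally show ?thesis .
  qed
  have "ennreal (1 / 2) * emeasure MI bad = (\<integral>\<^sup>+ x. ennreal (1 / 2) * indicator bad x \<partial>MI)"
    by (subst nn_integral_cmult) auto
  also have "\<dots> \<le> (\<integral>\<^sup>+ x. (\<integral>\<^sup>+ y. indicator D (merge I J (x, y)) \<partial>MJ) \<partial>MI)"
    using half by (intro nn_integral_mono) (auto simp: indicator_def)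
  also have "\<dots> = (\<integral>\<^sup>+ z. indicator D z \<partial>N)"
    using prod.product_nn_integral_fold[OF IJ(2-4), of "indicator D"] Dset
    unfolding MI_def MJ_def N_def IJ(1) by simp
  also have "\<dots> = emeasure N D" by simp
  also have "\<dots> \<le> ennreal (2 * G * exp (- (t\<^sup>2 / (2 * n))))"
    unfolding D_def N_def using \<epsilon> by (intro emeasure_symmetrized_deviation_le cnt sets n growth) (auto simp: t_def)
  finally have "ennreal (1 / 2) * emeasure MI bad \<le> ennreal (2 * G * exp (- (t\<^sup>2 / (2 * n))))" .
  then have "ennreal (1 / 2 * MI.prob bad) \<le> ennreal (2 * G * exp (- (t\<^sup>2 / (2 * n))))"
    by (simp only: MI.emeasure_eq_measure ennreal_mult' zero_le_divide_1_iff zero_le_numeral)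
  then have "MI.prob bad \<le> 4 * G * exp (- (t\<^sup>2 / (2 * n)))"
    using G by (subst (asm) ennreal_le_iff) auto
  also have "t\<^sup>2 / (2 * n) = n * \<epsilon>\<^sup>2 / 8"
    using n by (simp add: t_def power2_eq_square field_simps)
  finally show ?thesis by (simp add: bad_def MI_def I_def)
qed

section \<open>Gaussian densities\<close>

abbreviation qform :: "nat \<Rightarrow> (nat \<Rightarrow> nat \<Rightarrow> real) \<Rightarrow> (nat \<Rightarrow> real) \<Rightarrow> real" where
  "qform d Q v \<equiv> \<Sum>i<d. \<Sum>j<d. v i * Q i j * v j"

text \<open>Bridge to the matrix type, where products and block formulas for determinants are
  available.\<close>

definition index_mat :: "nat \<Rightarrow> (nat \<Rightarrow> nat \<Rightarrow> real) \<Rightarrow> real mat" where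
  "index_mat d A = mat d d (\<lambda>(i, j). A i j)"

lemma index_mat_carrier [simp]: "index_mat d A \<in> carrier_mat d d"
  by (simp add: index_mat_def)

lemma mdet_eq_det: "mdet d A = det (index_mat d A)"
proof -
  have "(\<Prod>i = 0..<d. A i (p i)) = (\<Prod>i = 0..<d. index_mat d A $$ (i, p i))"
    if p: "p permutes {0..<d}" for p
  proof (rule prod.cong)
    fix i assume i: "i \<in> {0..<d}"
    then have "p i \<in> {0..<d}" using permutes_in_image[OF p, of i] by blast
    then show "A i (p i) = index_mat d A $$ (i, p i)" using i by (simp add: index_mat_def)
  qed simp
  then show ?thesis
    unfolding mdet_def det_def'[OF index_mat_carrier] lessThan_atLeast0
    by (intro sum.cong refl) simp
qed

lemma index_mat_mult: "index_mat d A * index_mat d B = index_mat d (\<lambda>i j. \<Sum>l<d. A i l * B l j)"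
  by (rule eq_matI) (auto simp: index_mat_def scalar_prod_def lessThan_atLeast0)

definition schur_compl :: "nat \<Rightarrow> (nat \<Rightarrow> nat \<Rightarrow> real) \<Rightarrow> nat \<Rightarrow> nat \<Rightarrow> real" where
  "schur_compl d Q i j = Q i j - Q i d * Q d j / Q d d"

lemma mdet_Suc_schur:
  assumes "Q d d \<noteq> 0"
  shows "mdet (Suc d) Q = Q d d * mdet d (schur_compl d Q)"
proof -
  \<comment> \<open>Unit lower triangular: multiplying by U on the right subtracts multiples of the
    last column and clears the last row of Q except for its diagonal entry.\<close>
  define U where "U = (\<lambda>i j. if i = j then 1 else if i = d then - Q d j / Q d d else 0)"
  have "index_mat (Suc d) Q * index_mat (Suc d) U = four_block_mat (index_mat d (schur_compl d Q))
      (mat d 1 (\<lambda>(i, j). Q i d)) (0\<^sub>m 1 d) (mat 1 1 (\<lambda>_. Q d d))" (is "_ = ?F")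
  proof (rule eq_matI)
    fix i j assume "i < dim_row ?F" "j < dim_col ?F"
    then have ij: "i < Suc d" "j < Suc d" by (auto simp: index_mat_def)
    have *: "(\<Sum>l<Suc d. Q i l * U l j) = (if j < d then Q i j - Q i d * Q d j / Q d d else Q i d)"
    proof (cases "j < d")
      case True
      have "(\<Sum>l<d. Q i l * U l j) = (\<Sum>l<d. if l = j then Q i j else 0)"
        by (intro sum.cong) (auto simp: U_def)
      then show ?thesis using True by (simp add: U_def)
    next
      case False
      then have [simp]: "j = d" using ij by simp
      have "(\<Sum>l<d. Q i l * U l j) = 0" by (intro sum.neutral) (auto simp: U_def)
      then show ?thesis by (simp add: U_def)
    qed
    show "(index_mat (Suc d) Q * index_mat (Suc d) U) $$ (i, j) = ?F $$ (i, j)"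
      unfolding index_mat_mult using ij assms *
      by (auto simp: index_mat_def schur_compl_def less_Suc_eq)
  qed (auto simp: index_mat_def)
  then have "det (index_mat (Suc d) Q) * det (index_mat (Suc d) U) = det ?F"
    using det_mult[of "index_mat (Suc d) Q" "Suc d" "index_mat (Suc d) U"] by simp
  also have "\<dots> = det (index_mat d (schur_compl d Q)) * det (mat 1 1 (\<lambda>_. Q d d))"
    by (rule det_four_block_mat_lower_left_zero) auto
  also have "det (mat 1 1 (\<lambda>_. Q d d)) = Q d d" by (simp add: det_single)
  also have "det (index_mat (Suc d) U) = 1"
  proof -
    have "det (index_mat (Suc d) U) = prod_list (diag_mat (index_mat (Suc d) U))"
      by (rule det_lower_triangular[of "Suc d"]) (auto simp: index_mat_def U_def)
    also have "diag_mat (index_mat (Suc d) U) = replicate (Suc d) 1"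
      by (rule nth_equalityI) (auto simp: diag_mat_def index_mat_def U_def simp del: upt_Suc replicate_Suc)
    finally show ?thesis by simp
  qed
  finally show ?thesis by (simp add: mdet_eq_det)
qed

text \<open>Isolates the last coordinate in a single square, so that it can be integrated out while
  the other coordinates are fixed.\<close>

lemma qform_complete_square:
  assumes "Q d d \<noteq> 0" and sym: "\<And>i. i < d \<Longrightarrow> Q i d = Q d i"
  shows "qform (Suc d) Q v = Q d d * (v d + (\<Sum>j<d. Q d j * v j) / Q d d)\<^sup>2 + qform d (schur_compl d Q) v"
proof -
  define b where "b = (\<Sum>j<d. Q d j * v j)"
  have b': "(\<Sum>i<d. v i * Q i d * v d) = b * v d" "(\<Sum>j<d. v d * Q d j * v j) = v d * b"
    using sym by (simp_all add: b_def sum_distrib_left sum_distrib_right mult_ac)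
  have "qform d (schur_compl d Q) v = (\<Sum>i<d. \<Sum>j<d. v i * Q i j * v j - (Q d i * v i) * (Q d j * v j) / Q d d)"
    using sym by (intro sum.cong refl) (simp add: schur_compl_def field_simps)
  also have "\<dots> = qform d Q v - b * b / Q d d"
    by (simp add: sum_subtractf b_def sum_product sum_divide_distrib)
  finally have S: "qform d (schur_compl d Q) v = qform d Q v - b * b / Q d d" .
  have "qform (Suc d) Q v = qform d Q v + 2 * b * v d + Q d d * (v d)\<^sup>2"
    by (simp add: sum.distrib b' power2_eq_square)
  then show ?thesis unfolding S b_def[symmetric] using assms(1)
    by (simp add: field_simps power2_eq_square)
qed

lemma pos_def_diag: "pos_def d Q \<Longrightarrow> i < d \<Longrightarrow> Q i i > 0"
proof -
  assume Q: "pos_def d Q" and i: "i < d"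
  define v where "v = (\<lambda>l. if l = i then 1 else 0 :: real)"
  have "qform d Q v > 0" using Q i unfolding pos_def_def v_def by (auto intro!: exI[of _ i])
  also have "qform d Q v = (\<Sum>l<d. if l = i then Q i i else 0)"
  proof (intro sum.cong refl)
    fix l
    have "(\<Sum>j<d. v l * Q l j * v j) = (\<Sum>j<d. if j = i then v l * Q l i else 0)"
      by (intro sum.cong) (auto simp: v_def)
    then show "(\<Sum>j<d. v l * Q l j * v j) = (if l = i then Q i i else 0)"
      using i by (auto simp: v_def)
  qed
  also have "\<dots> = Q i i" using i by simp
  finally show ?thesis .
qed

lemma pos_def_schur_compl:
  assumes Q: "pos_def (Suc d) Q"
  shows "pos_def d (schur_compl d Q)"
proof -
  have sym: "Q i j = Q j i" if "i < Suc d" "j < Suc d" for i j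
    using Q that by (simp add: pos_def_def)
  have q: "Q d d > 0" using pos_def_diag[OF Q] by simp
  show ?thesis unfolding pos_def_def
  proof (intro conjI allI impI)
    fix i j assume "i < d" "j < d"
    then show "schur_compl d Q i j = schur_compl d Q j i"
      using sym[of i j] sym[of i d] sym[of j d] by (simp add: schur_compl_def)
  next
    fix v :: "nat \<Rightarrow> real" assume "\<exists>i<d. v i \<noteq> 0"
    \<comment> \<open>The last coordinate is the one for which the completed square
      vanishes.\<close>
    define v' where "v' = v(d := - (\<Sum>j<d. Q d j * v j) / Q d d)"
    have "\<exists>i<Suc d. v' i \<noteq> 0" using \<open>\<exists>i<d. v i \<noteq> 0\<close> by (auto simp: v'_def)
    then have "0 < qform (Suc d) Q v'" using Q unfolding pos_def_def by blast
    also have "\<dots> = qform d (schur_compl d Q) v'"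
      using q sym by (subst qform_complete_square) (auto simp: v'_def)
    also have "\<dots> = qform d (schur_compl d Q) v" by (simp add: v'_def)
    finally show "0 < qform d (schur_compl d Q) v" .
  qed
qed

lemma nn_integral_gaussian_1d:
  assumes "q > 0"
  shows "(\<integral>\<^sup>+ y. ennreal (exp (- (1/2) * (q * (y - c)\<^sup>2))) \<partial>lborel) = ennreal (sqrt (2 * pi / q))"
proof -
  define \<sigma> where "\<sigma> = 1 / sqrt q"
  have s: "\<sigma> > 0" "\<sigma>\<^sup>2 = 1 / q" using assms by (auto simp: \<sigma>_def power_divide)
  have e: "exp (- (1/2) * (q * (y - c)\<^sup>2)) = sqrt (2 * pi / q) * normal_density c \<sigma> y" for y
    using assms by (simp add: normal_density_def s field_simps)
  have "(\<integral>\<^sup>+ y. ennreal (normal_density c \<sigma> y) \<partial>lborel) = 1"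
    using s by (subst nn_integral_eq_integral) auto
  then show ?thesis
    using assms unfolding e by (simp add: ennreal_mult' nn_integral_cmult)
qed

lemma measurable_component_Leb [measurable]: "i < d \<Longrightarrow> (\<lambda>x. x i) \<in> borel_measurable (Leb d)"
  unfolding Leb_def using measurable_component_singleton[of i "{..<d}" "\<lambda>_. lborel :: real measure"] by simp

text \<open>Integrating out the last coordinate leaves the same integral for the Schur complement,
  and the determinant splits off the same pivot. Positivity of the determinant is carried through
  the same induction. Here Q is the inverse covariance.\<close>

lemma gaussian_integral:
  assumes "pos_def d Q"
  shows "mdet d Q > 0 \<and> (\<forall>m. (\<integral>\<^sup>+ x. ennreal (exp (- (1/2) * qform d Q (\<lambda>i. x i - m i))) \<partial>Leb d)
     = ennreal ((2 * pi) powr (real d / 2) / sqrt (mdet d Q)))"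
  using assms
proof (induction d arbitrary: Q)
  case 0
  have "mdet 0 Q = 1" by (simp add: mdet_eq_det)
  then show ?case by (simp add: Leb_def PiM_empty nn_integral_count_space_finite)
next
  case (Suc d)
  interpret product_sigma_finite "\<lambda>_::nat. lborel :: real measure" ..
  define S where "S = schur_compl d Q"
  have sym: "\<And>i. i < d \<Longrightarrow> Q i d = Q d i" using Suc.prems by (simp add: pos_def_def)
  have q: "Q d d > 0" using pos_def_diag[OF Suc.prems] by simp
  have IH: "mdet d S > 0"
    "\<And>m. (\<integral>\<^sup>+ x. ennreal (exp (- (1/2) * qform d S (\<lambda>i. x i - m i))) \<partial>Leb d)
     = ennreal ((2 * pi) powr (real d / 2) / sqrt (mdet d S))"
    using Suc.IH[OF pos_def_schur_compl[OF Suc.prems]] by (auto simp: S_def)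
  have det: "mdet (Suc d) Q = Q d d * mdet d S"
    unfolding S_def using q by (intro mdet_Suc_schur) auto
  have "(\<integral>\<^sup>+ x. ennreal (exp (- (1/2) * qform (Suc d) Q (\<lambda>i. x i - m i))) \<partial>Leb (Suc d))
     = ennreal ((2 * pi) powr (real (Suc d) / 2) / sqrt (mdet (Suc d) Q))" for m
  proof -
    define f where "f = (\<lambda>x. ennreal (exp (- (1/2) * qform (Suc d) Q (\<lambda>i. x i - m i))))"
    have fm: "f \<in> borel_measurable (PiM (insert d {..<d}) (\<lambda>_. lborel))"
    proof -
      have "f \<in> borel_measurable (Leb (Suc d))" unfolding f_def by measurable
      then show ?thesis by (simp add: Leb_def lessThan_Suc)
    qed
    have "(\<integral>\<^sup>+ x. f x \<partial>Leb (Suc d)) = (\<integral>\<^sup>+ x. (\<integral>\<^sup>+ y. f (x(d := y)) \<partial>lborel) \<partial>Leb d)"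
      unfolding Leb_def lessThan_Suc by (rule product_nn_integral_insert[OF _ _ fm]) auto
    also have "\<dots> = (\<integral>\<^sup>+ x. ennreal (sqrt (2 * pi / Q d d)) * ennreal (exp (- (1/2) * qform d S (\<lambda>i. x i - m i))) \<partial>Leb d)"
    proof (intro nn_integral_cong)
      fix x :: "nat \<Rightarrow> real"
      \<comment> \<open>The conditional mean of coordinate d given the others.\<close>
      define c where "c = m d - (\<Sum>j<d. Q d j * (x j - m j)) / Q d d"
      have "f (x(d := y)) = ennreal (exp (- (1/2) * qform d S (\<lambda>i. x i - m i))) * ennreal (exp (- (1/2) * (Q d d * (y - c)\<^sup>2)))" for y
      proof -
        have "qform (Suc d) Q (\<lambda>i. (x(d := y)) i - m i) =
           Q d d * ((x(d := y)) d - m d + (\<Sum>j<d. Q d j * ((x(d := y)) j - m j)) / Q d d)\<^sup>2 + qform d S (\<lambda>i. (x(d := y)) i - m i)"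
          unfolding S_def using q sym by (intro qform_complete_square) auto
        also have "\<dots> = Q d d * (y - c)\<^sup>2 + qform d S (\<lambda>i. x i - m i)"
          by (simp add: c_def algebra_simps)
        finally have qe: "qform (Suc d) Q (\<lambda>i. (x(d := y)) i - m i) = Q d d * (y - c)\<^sup>2 + qform d S (\<lambda>i. x i - m i)" .
        show ?thesis unfolding f_def qe
          by (simp only: ennreal_mult'[symmetric] mult_exp_exp exp_ge_zero distrib_left add.commute)
      qed
      moreover have gm: "(\<lambda>y. exp (- (1/2) * (Q d d * (y - c)\<^sup>2))) \<in> borel_measurable lborel"
        unfolding measurable_lborel2 by (intro borel_measurable_continuous_onI continuous_intros)
      ultimately have "(\<integral>\<^sup>+ y. f (x(d := y)) \<partial>lborel) = ennreal (exp (- (1/2) * qform d S (\<lambda>i. x i - m i))) * (\<integral>\<^sup>+ y. ennreal (exp (- (1/2) * (Q d d * (y - c)\<^sup>2))) \<partial>lborel)"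
        by (simp only:)
          (intro nn_integral_cmult measurable_compose[OF _ measurable_ennreal] gm)
      then show "(\<integral>\<^sup>+ y. f (x(d := y)) \<partial>lborel) = ennreal (sqrt (2 * pi / Q d d)) * ennreal (exp (- (1/2) * qform d S (\<lambda>i. x i - m i)))"
        by (simp only: nn_integral_gaussian_1d[OF q] mult.commute)
    qed
    also have "\<dots> = ennreal (sqrt (2 * pi / Q d d)) * ennreal ((2 * pi) powr (real d / 2) / sqrt (mdet d S))"
      by (subst nn_integral_cmult) (simp_all only: IH(2), measurable)
    also have "\<dots> = ennreal ((2 * pi) powr (real (Suc d) / 2) / sqrt (mdet (Suc d) Q))"
    proof -
      have "(2 * pi) powr (real (Suc d) / 2) = sqrt (2 * pi) * (2 * pi) powr (real d / 2)"
        by (simp add: powr_half_sqrt[symmetric] powr_add[symmetric] add_divide_distrib)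
      then show ?thesis using q IH(1)
        by (simp add: ennreal_mult'[symmetric] det real_sqrt_mult real_sqrt_divide)
    qed
    finally show ?thesis unfolding f_def .
  qed
  then show ?case using det q IH(1) by simp
qed

section \<open>Inverses of positive definite matrices\<close>

lemma minv_right_inverse:
  assumes "mdet d A \<noteq> 0" "i < d" "j < d"
  shows "(\<Sum>l<d. A i l * minv d A l j) = (if i = j then 1 else 0)"
proof -
  have "det (index_mat d A) \<noteq> 0" using assms by (simp add: mdet_eq_det)
  then obtain M where M: "M \<in> carrier_mat d d" "index_mat d A * M = 1\<^sub>m d"
    using det_non_zero_imp_unit[OF index_mat_carrier, of d A "()"]
    by (auto simp: Units_def ring_mat_def)
  have "\<forall>i<d. \<forall>j<d. (\<Sum>l<d. A i l * M $$ (l, j)) = (if i = j then 1 else 0)"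
  proof (intro allI impI)
    fix i j assume ij: "i < d" "j < d"
    have "(if i = j then 1 else 0) = (index_mat d A * M) $$ (i, j)" using ij M by simp
    also have "\<dots> = (\<Sum>l<d. A i l * M $$ (l, j))"
      using ij M(1) by (auto simp: index_mat_def scalar_prod_def lessThan_atLeast0)
    finally show "(\<Sum>l<d. A i l * M $$ (l, j)) = (if i = j then 1 else 0)" by simp
  qed
  then have "\<exists>B. \<forall>i<d. \<forall>j<d. (\<Sum>l<d. A i l * B l j) = (if i = j then 1 else 0)"
    by (intro exI[of _ "\<lambda>l j. M $$ (l, j)"])
  from someI_ex[OF this] show ?thesis using assms unfolding minv_def by blast
qed

lemma mdet_minv:
  assumes "mdet d A \<noteq> 0"
  shows "mdet d A * mdet d (minv d A) = 1"
proof -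
  have "index_mat d A * index_mat d (minv d A) = 1\<^sub>m d"
    unfolding index_mat_mult using minv_right_inverse[OF assms]
    by (intro eq_matI) (auto simp: index_mat_def)
  then show ?thesis
    using det_mult[of "index_mat d A" d "index_mat d (minv d A)"] by (simp add: mdet_eq_det)
qed

lemma sum_delta_mult:
  fixes f :: "nat \<Rightarrow> real"
  assumes "i < d"
  shows "(\<Sum>l<d. (if l = i then 1 else 0) * f l) = f i" "(\<Sum>l<d. (if i = l then 1 else 0) * f l) = f i"
    "(\<Sum>l<d. f l * (if l = i then 1 else 0)) = f i" "(\<Sum>l<d. f l * (if i = l then 1 else 0)) = f i"
  using assms by (simp_all add: if_distrib[of "\<lambda>x. x * _"] if_distrib[of "\<lambda>x. _ * x"] cong: if_cong)

lemma pos_def_minv: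
  assumes A: "pos_def d A"
  shows "pos_def d (minv d A)"
proof -
  define B where "B = minv d A"
  have symA: "A i j = A j i" if "i < d" "j < d" for i j using A that by (simp add: pos_def_def)
  have det: "mdet d A \<noteq> 0" using gaussian_integral[OF A] by simp
  have R: "(\<Sum>l<d. A i l * B l j) = (if i = j then 1 else 0)" if "i < d" "j < d" for i j
    using minv_right_inverse[OF det that] by (simp add: B_def)
  \<comment> \<open>Only A B = 1 is known. With A symmetric, both B and its transpose equal B^T A
    B.\<close>
  have symB: "B j i = B i j" if ij: "i < d" "j < d" for i j
  proof -
    have "B j i = (\<Sum>m<d. B m i * (if m = j then 1 else 0))" using ij by (simp add: sum_delta_mult)
    also have "\<dots> = (\<Sum>m<d. B m i * (\<Sum>l<d. A m l * B l j))" using ij R by simp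
    also have "\<dots> = (\<Sum>l<d. (\<Sum>m<d. A l m * B m i) * B l j)"
      unfolding sum_distrib_left sum_distrib_right
      by (subst sum.swap) (intro sum.cong refl, simp add: symA)
    also have "\<dots> = (\<Sum>l<d. (if l = i then 1 else 0) * B l j)" using ij R by simp
    also have "\<dots> = B i j" using ij by (simp add: sum_delta_mult)
    finally show ?thesis .
  qed
  have "0 < qform d B v" if v: "\<exists>i<d. v i \<noteq> 0" for v
  proof -
    \<comment> \<open>With w = B v one has v = A w, so the form of B at v is the form of A at
      w.\<close>
    define w where "w = (\<lambda>i. \<Sum>j<d. B i j * v j)"
    have Aw: "(\<Sum>j<d. A i j * w j) = v i" if "i < d" for i
    proof -
      have "(\<Sum>j<d. A i j * w j) = (\<Sum>l<d. (\<Sum>j<d. A i j * B j l) * v l)"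
        unfolding w_def sum_distrib_left sum_distrib_right
        by (subst sum.swap) (simp add: mult_ac)
      also have "\<dots> = (\<Sum>l<d. (if i = l then 1 else 0) * v l)" using that R by simp
      also have "\<dots> = v i" using that by (simp add: sum_delta_mult)
      finally show ?thesis .
    qed
    have "\<exists>i<d. w i \<noteq> 0"
    proof (rule ccontr)
      assume "\<not> (\<exists>i<d. w i \<noteq> 0)"
      then have "v i = 0" if "i < d" for i using Aw[OF that] by simp
      then show False using v by auto
    qed
    then have "0 < qform d A w" using A unfolding pos_def_def by blast
    also have "qform d A w = (\<Sum>i<d. w i * (\<Sum>j<d. A i j * w j))"
      by (simp add: sum_distrib_left mult_ac)
    also have "\<dots> = (\<Sum>i<d. v i * w i)" using Aw by (simp add: mult.commute)
    also have "\<dots> = qform d B v" by (simp add: w_def sum_distrib_left mult_ac)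
    finally show ?thesis .
  qed
  then show ?thesis using symB by (auto simp: pos_def_def B_def)
qed

section \<open>Gaussians and their mixtures are probability densities\<close>

lemma borel_measurable_gauss [measurable]: "gauss d \<mu> \<Sigma> \<in> borel_measurable (Leb d)"
  unfolding gauss_def by measurable

lemma gauss_pos: "pos_def d \<Sigma> \<Longrightarrow> gauss d \<mu> \<Sigma> x > 0"
  using gaussian_integral[of d \<Sigma>] by (simp add: gauss_def)

lemma nn_integral_gauss:
  assumes "pos_def d \<Sigma>"
  shows "(\<integral>\<^sup>+ x. ennreal (gauss d \<mu> \<Sigma> x) \<partial>Leb d) = 1"
proof -
  define Q where "Q = minv d \<Sigma>"
  define Z where "Z = (2 * pi) powr (real d / 2) * sqrt (mdet d \<Sigma>)"
  have dS: "mdet d \<Sigma> > 0" using gaussian_integral[OF assms] by simp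
  have dQ: "mdet d Q = 1 / mdet d \<Sigma>" using mdet_minv[of d \<Sigma>] dS by (simp add: Q_def field_simps)
  have Z: "Z > 0" using dS by (simp add: Z_def)
  have "(\<integral>\<^sup>+ x. ennreal (gauss d \<mu> \<Sigma> x) \<partial>Leb d)
      = (\<integral>\<^sup>+ x. ennreal (1 / Z) * ennreal (exp (- (1/2) * qform d Q (\<lambda>i. x i - \<mu> i))) \<partial>Leb d)"
    using Z by (intro nn_integral_cong) (simp add: gauss_def Z_def Q_def ennreal_mult'[symmetric])
  also have "\<dots> = ennreal (1 / Z) * (\<integral>\<^sup>+ x. ennreal (exp (- (1/2) * qform d Q (\<lambda>i. x i - \<mu> i))) \<partial>Leb d)"
    by (rule nn_integral_cmult) measurable
  also have "\<dots> = ennreal (1 / Z) * ennreal ((2 * pi) powr (real d / 2) / sqrt (mdet d Q))"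
    using gaussian_integral[OF pos_def_minv[OF assms]] by (simp add: Q_def)
  also have "(2 * pi) powr (real d / 2) / sqrt (mdet d Q) = Z"
    using dS by (simp add: dQ Z_def real_sqrt_divide)
  also have "ennreal (1 / Z) * ennreal Z = 1" using Z by (simp add: ennreal_mult'[symmetric])
  finally show ?thesis .
qed

lemma mixtures_density:
  assumes "f \<in> mixtures d k"
  shows "is_density d f" "f x \<ge> 0"
proof -
  from assms obtain w \<mu> \<Sigma> where w: "\<And>i. i < k \<Longrightarrow> w i \<ge> (0::real)" "(\<Sum>i<k. w i) = 1"
    and S: "\<And>i. i < k \<Longrightarrow> pos_def d (\<Sigma> i)" and f: "f = (\<lambda>x. \<Sum>i<k. w i * gauss d (\<mu> i) (\<Sigma> i) x)"
    by (auto simp: mixtures_def)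
  have g: "w i * gauss d (\<mu> i) (\<Sigma> i) x \<ge> 0" if "i < k" for i x
    using w(1)[OF that] gauss_pos[OF S[OF that]] by (simp add: less_imp_le)
  then have nn: "f x \<ge> 0" for x unfolding f by (intro sum_nonneg) auto
  show "f x \<ge> 0" by (rule nn)
  have "(\<integral>\<^sup>+ x. ennreal (f x) \<partial>Leb d) = (\<integral>\<^sup>+ x. (\<Sum>i<k. ennreal (w i * gauss d (\<mu> i) (\<Sigma> i) x)) \<partial>Leb d)"
    unfolding f using g by (intro nn_integral_cong sum_ennreal[symmetric]) auto
  also have "\<dots> = (\<Sum>i<k. \<integral>\<^sup>+ x. ennreal (w i * gauss d (\<mu> i) (\<Sigma> i) x) \<partial>Leb d)"
    by (rule nn_integral_sum) measurable
  also have "\<dots> = (\<Sum>i<k. ennreal (w i))"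
    using w(1) by (intro sum.cong refl) (simp add: ennreal_mult' nn_integral_cmult nn_integral_gauss[OF S])
  also have "\<dots> = 1" using w by (subst sum_ennreal) auto
  finally have one: "(\<integral>\<^sup>+ x. ennreal (f x) \<partial>Leb d) = 1" .
  have "f \<in> borel_measurable (Leb d)" unfolding f by measurable
  then show "is_density d f" using nn one by (simp add: is_density_def)
qed

section \<open>Mixtures as sums of exponentials of quadratic polynomials\<close>

text \<open>Homogeneous coordinates: the constant 1 at index d lets one bilinear expression hold the
  quadratic, linear and constant terms. Exponents are then linear in the parameters, as counting
  half-space patterns requires.\<close>

definition hom_coord :: "nat \<Rightarrow> (nat \<Rightarrow> real) \<Rightarrow> nat \<Rightarrow> real" where
  "hom_coord d x a = (if a < d then x a else 1)"

definition quad :: "nat \<Rightarrow> (nat \<times> nat \<times> nat \<Rightarrow> real) \<Rightarrow> nat \<Rightarrow> (nat \<Rightarrow> real) \<Rightarrow> real" where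
  "quad d \<theta> i x = (\<Sum>a\<le>d. \<Sum>b\<le>d. \<theta> (i, a, b) * (hom_coord d x a * hom_coord d x b))"

definition expmix :: "nat \<Rightarrow> nat \<Rightarrow> (nat \<times> nat \<times> nat \<Rightarrow> real) \<Rightarrow> (nat \<Rightarrow> real) \<Rightarrow> real" where
  "expmix d k \<theta> x = (\<Sum>i<k. exp (quad d \<theta> i x))"

lemma borel_measurable_quad [measurable]: "quad d \<theta> i \<in> borel_measurable (Leb d)"
proof -
  have "(\<lambda>x. hom_coord d x a) \<in> borel_measurable (Leb d)" for a
    unfolding hom_coord_def by (cases "a < d") auto
  then show ?thesis unfolding quad_def by measurable
qed

lemma borel_measurable_expmix [measurable]: "expmix d k \<theta> \<in> borel_measurable (Leb d)"
  unfolding expmix_def by measurable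

text \<open>A vanishing weight is replaced by part of a positive one, so that logarithms of the weights make sense.\<close>

lemma positive_weights:
  fixes w :: "nat \<Rightarrow> real"
  assumes w: "\<And>i. i < k \<Longrightarrow> w i \<ge> 0" "(\<Sum>i<k. w i) = 1"
  obtains w' r where "\<And>i. i < k \<Longrightarrow> w' i > (0 :: real)" "\<And>i. i < k \<Longrightarrow> r i < k"
    "\<And>h :: nat \<Rightarrow> real. (\<Sum>i<k. w' i * h (r i)) = (\<Sum>i<k. w i * h i)"
proof -
  have "\<exists>i<k. w i \<noteq> 0"
  proof (rule ccontr)
    assume "\<not> (\<exists>i<k. w i \<noteq> 0)"
    then show False using w(2) by simp
  qed
  then obtain i0 where i0: "i0 < k" "w i0 > 0" using w(1) by (auto simp: less_le)
  define Z where "Z = {i. i < k \<and> w i = 0}"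
  have Z: "finite Z" "i0 \<notin> Z" "Z \<subseteq> {..<k}" using i0 by (auto simp: Z_def)
  define c where "c = w i0 / (real (card Z) + 1)"
  define w' where "w' = (\<lambda>i. if i \<in> insert i0 Z then c else w i)"
  define r where "r = (\<lambda>i. if i \<in> Z then i0 else i)"
  have c: "c > 0" using i0 by (simp add: c_def)
  show thesis
  proof (rule that)
    fix i assume i: "i < k"
    show "w' i > 0" using i c w(1)[OF i] by (auto simp: w'_def Z_def less_le)
    show "r i < k" using i i0 by (simp add: r_def)
  next
    fix h :: "nat \<Rightarrow> real"
    define R where "R = {..<k} - insert i0 Z"
    have split: "(\<Sum>i<k. g i) = (\<Sum>i\<in>insert i0 Z. g i) + (\<Sum>i\<in>R. g i)" for g :: "nat \<Rightarrow> real"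
      unfolding R_def using Z i0 by (subst add.commute, intro sum.subset_diff) auto
    have "(\<Sum>i\<in>insert i0 Z. w' i * h (r i)) = (\<Sum>i\<in>insert i0 Z. c * h i0)"
      by (intro sum.cong) (auto simp: w'_def r_def)
    also have "\<dots> = (real (card Z) + 1) * c * h i0" using Z by simp
    also have "\<dots> = w i0 * h i0"
    proof -
      have "real (card Z) + 1 \<noteq> 0" by linarith
      then show ?thesis by (simp add: c_def)
    qed
    also have "\<dots> = (\<Sum>i\<in>insert i0 Z. w i * h i)"
    proof -
      have "(\<Sum>i\<in>Z. w i * h i) = 0" by (intro sum.neutral) (auto simp: Z_def)
      then show ?thesis using Z by simp
    qed
    finally have "(\<Sum>i\<in>insert i0 Z. w' i * h (r i)) = (\<Sum>i\<in>insert i0 Z. w i * h i)" .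
    moreover have "(\<Sum>i\<in>R. w' i * h (r i)) = (\<Sum>i\<in>R. w i * h i)"
      by (intro sum.cong) (auto simp: w'_def r_def R_def)
    ultimately show "(\<Sum>i<k. w' i * h (r i)) = (\<Sum>i<k. w i * h i)" unfolding split by simp
  qed
qed

lemma qform_as_quad:
  obtains T :: "nat \<Rightarrow> nat \<Rightarrow> real" where
    "\<And>x. c - (1/2) * qform d Q (\<lambda>i. x i - m i) = (\<Sum>a\<le>d. \<Sum>b\<le>d. T a b * (hom_coord d x a * hom_coord d x b))"
proof -
  \<comment> \<open>Row i of L holds the coefficients of x i - m i in homogeneous coordinates. The
    matrix T is -1/2 L^T Q L with c added to the constant entry (d, d).\<close>
  define L where "L = (\<lambda>i a. (if a = i then 1 else if a = d then - m i else 0 :: real))"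
  define T where "T = (\<lambda>a b. - (1/2) * (\<Sum>i<d. \<Sum>j<d. L i a * Q i j * L j b) + (if a = d then if b = d then c else 0 else 0))"
  show thesis
  proof (rule that[of T])
    fix x
    define h where "h = hom_coord d x"
    have hd: "h d = 1" by (simp add: h_def hom_coord_def)
    have lin: "x i - m i = (\<Sum>a\<le>d. L i a * h a)" if "i < d" for i
    proof -
      have "(\<Sum>a\<le>d. L i a * h a) = (\<Sum>a<d. L i a * h a) + L i d * h d"
        by (simp add: lessThan_Suc_atMost[symmetric])
      also have "(\<Sum>a<d. L i a * h a) = (\<Sum>a<d. (if a = i then 1 else 0) * h a)"
        by (intro sum.cong) (auto simp: L_def)
      also have "\<dots> = x i" using that by (simp add: sum_delta_mult h_def hom_coord_def)
      also have "L i d * h d = - m i" using that by (simp add: L_def hd)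
      finally show ?thesis by simp
    qed
    have "qform d Q (\<lambda>i. x i - m i) = (\<Sum>i<d. \<Sum>j<d. \<Sum>a\<le>d. \<Sum>b\<le>d. L i a * Q i j * L j b * (h a * h b))"
      using lin by (simp add: sum_product sum_distrib_left sum_distrib_right mult_ac)
    also have "\<dots> = (\<Sum>i<d. \<Sum>a\<le>d. \<Sum>j<d. \<Sum>b\<le>d. L i a * Q i j * L j b * (h a * h b))"
      by (intro sum.cong refl sum.swap)
    also have "\<dots> = (\<Sum>a\<le>d. \<Sum>i<d. \<Sum>b\<le>d. \<Sum>j<d. L i a * Q i j * L j b * (h a * h b))"
      by (subst sum.swap) (intro sum.cong refl sum.swap)
    also have "\<dots> = (\<Sum>a\<le>d. \<Sum>b\<le>d. \<Sum>i<d. \<Sum>j<d. L i a * Q i j * L j b * (h a * h b))"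
      by (intro sum.cong refl sum.swap)
    also have "\<dots> = (\<Sum>a\<le>d. \<Sum>b\<le>d. (\<Sum>i<d. \<Sum>j<d. L i a * Q i j * L j b) * (h a * h b))"
      by (simp only: sum_distrib_right)
    finally have q: "qform d Q (\<lambda>i. x i - m i) = (\<Sum>a\<le>d. \<Sum>b\<le>d. (\<Sum>i<d. \<Sum>j<d. L i a * Q i j * L j b) * (h a * h b))" .
    have cc: "c = (\<Sum>a\<le>d. \<Sum>b\<le>d. (if a = d then if b = d then c else 0 else 0) * (h a * h b))"
    proof -
      have "(\<Sum>b\<le>d. (if a = d then if b = d then c else 0 else 0) * (h a * h b)) = (if a = d then c else 0)" for a
        by (cases "a = d") (simp_all add: if_distrib[of "\<lambda>x. x * _"] hd cong: if_cong)
      then show ?thesis by simp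
    qed
    show "c - (1/2) * qform d Q (\<lambda>i. x i - m i) = (\<Sum>a\<le>d. \<Sum>b\<le>d. T a b * (hom_coord d x a * hom_coord d x b))"
      unfolding T_def h_def[symmetric] distrib_right sum.distrib cc[symmetric] q
      by (simp add: sum_distrib_left sum_negf mult.assoc)
        (simp add: sum_divide_distrib[symmetric] sum_distrib_left[symmetric])
  qed
qed

text \<open>The logarithm of weight over normalizing constant becomes the constant term of the
  exponent. A zero weight has no logarithm, so the weights are first made positive, with one
  component possibly repeated.\<close>

lemma mixture_as_expmix:
  assumes "f \<in> mixtures d k"
  obtains \<theta> where "f = expmix d k \<theta>"
proof -
  from assms obtain w \<mu> \<Sigma> where w: "\<And>i. i < k \<Longrightarrow> w i \<ge> (0::real)" "(\<Sum>i<k. w i) = 1"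
    and S: "\<And>i. i < k \<Longrightarrow> pos_def d (\<Sigma> i)" and f: "f = (\<lambda>x. \<Sum>i<k. w i * gauss d (\<mu> i) (\<Sigma> i) x)"
    by (auto simp: mixtures_def)
  obtain w' r where w': "\<And>i. i < k \<Longrightarrow> w' i > (0 :: real)" "\<And>i. i < k \<Longrightarrow> r i < k"
    "\<And>h :: nat \<Rightarrow> real. (\<Sum>i<k. w' i * h (r i)) = (\<Sum>i<k. w i * h i)"
    using positive_weights[OF w] by blast
  have "\<exists>T. \<forall>x. w' i * gauss d (\<mu> (r i)) (\<Sigma> (r i)) x
      = exp (\<Sum>a\<le>d. \<Sum>b\<le>d. T a b * (hom_coord d x a * hom_coord d x b))" if i: "i < k" for i
  proof -
    define Z where "Z = (2 * pi) powr (real d / 2) * sqrt (mdet d (\<Sigma> (r i)))"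
    have Z: "Z > 0" using gaussian_integral[OF S[OF w'(2)[OF i]]] by (simp add: Z_def)
    obtain T where T: "\<And>x. ln (w' i / Z) - (1/2) * qform d (minv d (\<Sigma> (r i))) (\<lambda>j. x j - \<mu> (r i) j)
        = (\<Sum>a\<le>d. \<Sum>b\<le>d. T a b * (hom_coord d x a * hom_coord d x b))"
      using qform_as_quad[where c = "ln (w' i / Z)" and d = d and Q = "minv d (\<Sigma> (r i))" and m = "\<mu> (r i)"] by blast
    have "w' i * gauss d (\<mu> (r i)) (\<Sigma> (r i)) x
        = exp (\<Sum>a\<le>d. \<Sum>b\<le>d. T a b * (hom_coord d x a * hom_coord d x b))" for x
      unfolding T[symmetric] gauss_def Z_def[symmetric] diff_conv_add_uminus exp_add
      using w'(1)[OF i] Z by simp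
    then show ?thesis by blast
  qed
  then have "\<forall>i. \<exists>T. i < k \<longrightarrow> (\<forall>x. w' i * gauss d (\<mu> (r i)) (\<Sigma> (r i)) x
      = exp (\<Sum>a\<le>d. \<Sum>b\<le>d. T a b * (hom_coord d x a * hom_coord d x b)))" by simp
  from choice[OF this] obtain T where T: "\<And>i x. i < k \<Longrightarrow> w' i * gauss d (\<mu> (r i)) (\<Sigma> (r i)) x
      = exp (\<Sum>a\<le>d. \<Sum>b\<le>d. T i a b * (hom_coord d x a * hom_coord d x b))" by blast
  have "f x = expmix d k (\<lambda>(i, a, b). T i a b) x" for x
    unfolding f expmix_def quad_def w'(3)[of "\<lambda>i. gauss d (\<mu> i) (\<Sigma> i) x", symmetric]
    by (intro sum.cong refl) (simp only: T lessThan_iff prod.case)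
  then show thesis using that by blast
qed

text \<open>Parameters are functions on a countable index type, a second countable space, so the set
  of parameters that give mixtures is separable. Coordinatewise convergence of parameters gives
  pointwise convergence of densities, which Scheffe's lemma upgrades to convergence in L1.\<close>

lemma countable_dense_expmix:
  obtains T where "countable T" "\<And>\<tau>. \<tau> \<in> T \<Longrightarrow> expmix d k \<tau> \<in> mixtures d k"
    "\<And>f \<eta>. f \<in> mixtures d k \<Longrightarrow> \<eta> > 0 \<Longrightarrow> \<exists>\<tau>\<in>T. L1dist d (expmix d k \<tau>) f \<le> ennreal \<eta>"
proof -
  obtain T where T: "countable T" "T \<subseteq> {\<theta>. expmix d k \<theta> \<in> mixtures d k}" "{\<theta>. expmix d k \<theta> \<in> mixtures d k} \<subseteq> closure T"
    by (rule separable)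
  show thesis
  proof (rule that[OF T(1)])
    fix f and \<eta> :: real assume f: "f \<in> mixtures d k" and \<eta>: "\<eta> > 0"
    obtain \<theta> where \<theta>: "f = expmix d k \<theta>" using mixture_as_expmix[OF f] .
    then have "\<theta> \<in> closure T" using T(3) f by auto
    then obtain \<tau> where \<tau>: "\<And>n. \<tau> n \<in> T" "\<tau> \<longlonglongrightarrow> \<theta>" by (auto simp: closure_sequential)
    have comp: "(\<lambda>n. \<tau> n p) \<longlonglongrightarrow> \<theta> p" for p
      using \<tau>(2) continuous_on_tendsto_compose[OF continuous_on_product_coordinates[of p], of \<tau> \<theta> sequentially] by simp
    have lim: "(\<lambda>n. expmix d k (\<tau> n) x) \<longlonglongrightarrow> f x" for x
      unfolding \<theta> expmix_def quad_def by (intro tendsto_intros comp)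
    have dens: "(\<integral>\<^sup>+ x. norm (h x) \<partial>Leb d) = 1" if "h \<in> mixtures d k" for h
      using mixtures_density[OF that] by (simp add: is_density_def)
    have "(\<lambda>n. \<integral>\<^sup>+ x. norm (expmix d k (\<tau> n) x - f x) \<partial>Leb d) \<longlonglongrightarrow> 0"
    \<comment> \<open>The norms must not exceed that of the limit; all of them are 1.\<close>
    proof (rule Scheffe_lemma2)
      show "integrable (Leb d) f"
        using mixtures_density(1)[OF f] dens[OF f] by (auto simp: integrable_iff_bounded is_density_def)
      show "(\<integral>\<^sup>+ x. norm (expmix d k (\<tau> n) x) \<partial>Leb d) \<le> (\<integral>\<^sup>+ x. norm (f x) \<partial>Leb d)" for n
        using dens[OF f] dens[of "expmix d k (\<tau> n)"] T(2) \<tau>(1)[of n] by auto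
    qed (use lim in auto)
    then have "eventually (\<lambda>n. (\<integral>\<^sup>+ x. norm (expmix d k (\<tau> n) x - f x) \<partial>Leb d) < ennreal \<eta>) sequentially"
      using \<eta> by (intro order_tendstoD) auto
    then obtain n where "(\<integral>\<^sup>+ x. norm (expmix d k (\<tau> n) x - f x) \<partial>Leb d) < ennreal \<eta>"
      by (auto simp: eventually_sequentially)
    then show "\<exists>\<tau>\<in>T. L1dist d (expmix d k \<tau>) f \<le> ennreal \<eta>"
      using \<tau>(1)[of n] by (intro bexI[of _ "\<tau> n"]) (simp_all add: L1dist_def less_imp_le)
  qed (use T(2) in auto)
qed

section \<open>Test sets\<close>

text \<open>A triple records whether the deficit z j - z i lies below l * \<eta>. Resolution stops
  at L * \<eta>, chosen later so that exp of minus that deficit is at most \<eta>. Pairwise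
  differences make the pattern invariant under adding a constant to all exponents, that is, under
  scaling both sums.\<close>

definition level_pattern :: "nat \<Rightarrow> nat \<Rightarrow> real \<Rightarrow> (nat \<Rightarrow> real) \<Rightarrow> (nat \<times> nat \<times> nat) set" where
  "level_pattern K L \<eta> z = {(i, j, l) \<in> {..<K} \<times> {..<K} \<times> {..L}. z i - z j + real l * \<eta> > 0}"

lemma exp_minus_Lipschitz: "0 \<le> u \<Longrightarrow> 0 \<le> v \<Longrightarrow> \<bar>exp (- u) - exp (- v)\<bar> \<le> \<bar>u - v\<bar>" for u v :: real
proof (induction u v rule: linorder_wlog)
  case (le u v)
  have "exp (- u) - exp (- v) = exp (- u) * (1 - exp (u - v))"
    by (simp add: algebra_simps mult_exp_exp)
  also have "\<dots> \<le> 1 * (v - u)"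
  proof (intro mult_mono)
    show "1 - exp (u - v) \<le> v - u" using exp_ge_add_one_self[of "u - v"] by linarith
  qed (use le in auto)
  finally show ?case using le by simp
qed (simp add: abs_minus_commute)

text \<open>After division by the largest term, only the deficits below the maximum matter. Equal
  patterns put both deficits of i into the same cell of width \<eta>, where exp (- u) is
  1-Lipschitz, or both beyond the last level, where both exponentials are at most \<eta>.\<close>

lemma level_pattern_exp_close:
  assumes pat: "level_pattern K L \<eta> z = level_pattern K L \<eta> z'"
    and \<eta>: "\<eta> > 0" "exp (- (real L * \<eta>)) \<le> \<eta>"
    and m: "m < K" "\<And>i. i < K \<Longrightarrow> z' i \<le> z' m" and i: "i < K"
  shows "\<bar>exp (z i - z m) - exp (z' i - z' m)\<bar> \<le> \<eta>"
proof -
  define u where "u = z m - z i"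
  define u' where "u' = z' m - z' i"
  have lev: "u < real l * \<eta> \<longleftrightarrow> u' < real l * \<eta>" if "l \<le> L" for l
  proof -
    have "(i, m, l) \<in> level_pattern K L \<eta> z \<longleftrightarrow> (i, m, l) \<in> level_pattern K L \<eta> z'" using pat by simp
    then show ?thesis using i m(1) that by (auto simp: level_pattern_def u_def u'_def algebra_simps)
  qed
  have u': "u' \<ge> 0" using m(2)[OF i] by (simp add: u'_def)
  \<comment> \<open>Level 0 compares the exponents themselves, so the maximal index of z' is also
    maximal for z.\<close>
  then have u: "u \<ge> 0" using lev[of 0] by simp
  have "\<bar>exp (- u) - exp (- u')\<bar> \<le> \<eta>"
  proof (cases "u < real L * \<eta>")
    case True
    \<comment> \<open>Both deficits lie between (l - 1) * \<eta> and l * \<eta>.\<close>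
    define l where "l = (LEAST l. u < real l * \<eta>)"
    have l: "u < real l * \<eta>" "l \<le> L" using True unfolding l_def by (auto intro: LeastI Least_le)
    have "l \<noteq> 0" using l u by (intro notI) simp
    then obtain l' where l': "l = Suc l'" by (cases l) auto
    have "\<not> u < real l' * \<eta>" using not_less_Least[of l' "\<lambda>l. u < real l * \<eta>"] l' l_def by simp
    then have "real l' * \<eta> \<le> u" "real l' * \<eta> \<le> u'" "u' < real l * \<eta>" "u < real l * \<eta>"
      using lev[of l'] lev[of l] l l' by auto
    then have "\<bar>u - u'\<bar> \<le> \<eta>" using l' by (simp add: algebra_simps)
    then show ?thesis using exp_minus_Lipschitz[OF u u'] by linarith
  next
    case False
    then have "exp (- u) \<le> exp (- (real L * \<eta>))" "exp (- u') \<le> exp (- (real L * \<eta>))"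
      using lev[of L] by auto
    then have "exp (- u) \<le> \<eta>" "exp (- u') \<le> \<eta>" using \<eta> by linarith+
    then show ?thesis using exp_gt_zero[of "- u"] exp_gt_zero[of "- u'"] by linarith
  qed
  then show ?thesis by (simp add: u_def u'_def)
qed

text \<open>Equal patterns nearly preserve the order of the two sums. In units of the maximal term
  each of the 2 k terms moves by at most \<eta>, and that unit is itself a summand. The error is
  thus relative to the sum of both mixtures and can be integrated whatever the dimension.\<close>

lemma level_pattern_compare:
  assumes pat: "level_pattern (2 * k) L \<eta> z = level_pattern (2 * k) L \<eta> z'"
    and \<eta>: "\<eta> > 0" "exp (- (real L * \<eta>)) \<le> \<eta>" and k: "k > 0"
    and gt: "(\<Sum>i<k. exp (z i)) > (\<Sum>i<k. exp (z (i + k)))"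
  shows "(\<Sum>i<k. exp (z' (i + k))) - (\<Sum>i<k. exp (z' i))
    \<le> 2 * real k * \<eta> * ((\<Sum>i<k. exp (z' i)) + (\<Sum>i<k. exp (z' (i + k))))"
proof -
  obtain m where m: "m < 2 * k" "\<And>i. i < 2 * k \<Longrightarrow> z' i \<le> z' m"
  proof -
    have "Max (z' ` {..<2 * k}) \<in> z' ` {..<2 * k}" using k by (intro Max_in) (auto simp: lessThan_empty_iff)
    then obtain m where "m < 2 * k" "Max (z' ` {..<2 * k}) = z' m" by auto
    moreover have "z' i \<le> Max (z' ` {..<2 * k})" if "i < 2 * k" for i using that by (intro Max_ge) auto
    ultimately show thesis using that by auto
  qed
  define e where "e = (\<lambda>i. exp (z i - z m))"
  define e' where "e' = (\<lambda>i. exp (z' i - z' m))"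
  have close: "\<bar>e i - e' i\<bar> \<le> \<eta>" if "i < 2 * k" for i
    using level_pattern_exp_close[OF pat \<eta> m that] by (simp add: e_def e'_def)
  have ex: "exp (z i) = exp (z m) * e i" "exp (z' i) = exp (z' m) * e' i" for i
    by (simp_all add: e_def e'_def mult_exp_exp)
  have sums: "(\<Sum>i<k. exp (z i)) = exp (z m) * (\<Sum>i<k. e i)" "(\<Sum>i<k. exp (z (i + k))) = exp (z m) * (\<Sum>i<k. e (i + k))"
    "(\<Sum>i<k. exp (z' i)) = exp (z' m) * (\<Sum>i<k. e' i)" "(\<Sum>i<k. exp (z' (i + k))) = exp (z' m) * (\<Sum>i<k. e' (i + k))"
    unfolding sum_distrib_left by (intro sum.cong refl ex)+
  have "exp (z m) * (\<Sum>i<k. e (i + k)) < exp (z m) * (\<Sum>i<k. e i)"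
    using gt by (simp only: sums)
  then have gt': "(\<Sum>i<k. e (i + k)) < (\<Sum>i<k. e i)" by simp
  have hi: "e' (i + k) \<le> e (i + k) + \<eta>" if "i < k" for i using close[of "i + k"] that by linarith
  have lo: "e i \<le> e' i + \<eta>" if "i < k" for i using close[of i] that by linarith
  have "(\<Sum>i<k. e' (i + k)) \<le> (\<Sum>i<k. e (i + k) + \<eta>)" using hi by (intro sum_mono) simp
  also have "\<dots> \<le> (\<Sum>i<k. e i) + k * \<eta>" using gt' by (simp add: sum.distrib)
  also have "(\<Sum>i<k. e i) \<le> (\<Sum>i<k. e' i + \<eta>)" using lo by (intro sum_mono) simp
  finally have d: "(\<Sum>i<k. e' (i + k)) - (\<Sum>i<k. e' i) \<le> 2 * k * \<eta>" by (simp add: sum.distrib algebra_simps)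
  have big: "exp (z' m) \<le> (\<Sum>i<k. exp (z' i)) + (\<Sum>i<k. exp (z' (i + k)))"
  proof (cases "m < k")
    case True
    then have "exp (z' m) \<le> (\<Sum>i<k. exp (z' i))" by (intro member_le_sum) auto
    moreover have "0 \<le> (\<Sum>i<k. exp (z' (i + k)))" by (intro sum_nonneg) auto
    ultimately show ?thesis by linarith
  next
    case False
    then have "exp (z' ((m - k) + k)) \<le> (\<Sum>i<k. exp (z' (i + k)))"
      using m(1) by (intro member_le_sum[of "m - k" _ "\<lambda>i. exp (z' (i + k))"]) auto
    moreover have "0 \<le> (\<Sum>i<k. exp (z' i))" by (intro sum_nonneg) auto
    ultimately show ?thesis using False by simp
  qed
  have "(\<Sum>i<k. exp (z' (i + k))) - (\<Sum>i<k. exp (z' i)) = exp (z' m) * ((\<Sum>i<k. e' (i + k)) - (\<Sum>i<k. e' i))"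
    by (simp only: sums right_diff_distrib)
  also have "\<dots> \<le> exp (z' m) * (2 * k * \<eta>)" using d by (intro mult_left_mono) auto
  also have "\<dots> \<le> ((\<Sum>i<k. exp (z' i)) + (\<Sum>i<k. exp (z' (i + k)))) * (2 * k * \<eta>)"
    using big \<eta> by (intro mult_right_mono) auto
  finally show ?thesis by (simp only: mult.commute)
qed

section \<open>Surrogate Scheffe sets and their traces on a sample\<close>

definition join_params :: "nat \<Rightarrow> (nat \<times> nat \<times> nat \<Rightarrow> real) \<Rightarrow> (nat \<times> nat \<times> nat \<Rightarrow> real) \<Rightarrow> nat \<times> nat \<times> nat \<Rightarrow> real" where
  "join_params k \<theta> \<theta>' = (\<lambda>(i, a, b). if i < k then \<theta> (i, a, b) else \<theta>' (i - k, a, b))"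

lemma quad_join_params:
  "quad d (join_params k \<theta> \<theta>') i x = (if i < k then quad d \<theta> i x else quad d \<theta>' (i - k) x)"
  by (simp add: quad_def join_params_def)

text \<open>A surrogate for the Scheffe set of two mixtures that depends on the point only through the
  level pattern of the exponents of all components of both mixtures.\<close>

definition good_pattern :: "nat \<Rightarrow> nat \<Rightarrow> real \<Rightarrow> (nat \<times> nat \<times> nat) set \<Rightarrow> bool" where
  "good_pattern k L \<eta> P \<longleftrightarrow>
     (\<exists>z. level_pattern (2 * k) L \<eta> z = P \<and> (\<Sum>i<k. exp (z i)) > (\<Sum>i<k. exp (z (i + k))))"

definition test_set :: "nat \<Rightarrow> nat \<Rightarrow> nat \<Rightarrow> real \<Rightarrow> (nat \<times> nat \<times> nat \<Rightarrow> real) \<Rightarrow> (nat \<Rightarrow> real) set" where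
  "test_set d k L \<eta> \<psi> = {x\<in>space (Leb d). good_pattern k L \<eta> (level_pattern (2 * k) L \<eta> (\<lambda>i. quad d \<psi> i x))}"

text \<open>Measurability comes from finiteness: there are finitely many patterns, each cut out by
  finitely many inequalities between measurable functions.\<close>

lemma test_set_sets [measurable]: "test_set d k L \<eta> \<psi> \<in> sets (Leb d)"
proof -
  let ?A = "{..<2 * k} \<times> {..<2 * k} \<times> {..L}"
  let ?pat = "\<lambda>x. level_pattern (2 * k) L \<eta> (\<lambda>i. quad d \<psi> i x)"
  have sub: "level_pattern K L \<eta> z \<subseteq> {..<K} \<times> {..<K} \<times> {..L}" for K z by (auto simp: level_pattern_def)
  have "test_set d k L \<eta> \<psi> = (\<Union>P\<in>{P \<in> Pow ?A. good_pattern k L \<eta> P}. {x\<in>space (Leb d). ?pat x = P})"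
    using sub by (auto simp: test_set_def)
  also have "\<dots> \<in> sets (Leb d)"
  proof (intro sets.finite_UN)
    fix P assume "P \<in> {P \<in> Pow ?A. good_pattern k L \<eta> P}"
    then have P: "P \<subseteq> ?A" by auto
    have "{x\<in>space (Leb d). ?pat x = P} = {x\<in>space (Leb d). \<forall>t\<in>?A. (t \<in> P) =
        (quad d \<psi> (fst t) x - quad d \<psi> (fst (snd t)) x + real (snd (snd t)) * \<eta> > 0)}"
    proof (intro Collect_cong conj_cong refl)
      fix x
      have "?pat x = P \<longleftrightarrow> (\<forall>t\<in>?A. t \<in> P \<longleftrightarrow> t \<in> ?pat x)"
        using P sub[of "2 * k" "\<lambda>i. quad d \<psi> i x"] by blast
      also have "\<dots> \<longleftrightarrow> (\<forall>t\<in>?A. t \<in> P \<longleftrightarrow> quad d \<psi> (fst t) x - quad d \<psi> (fst (snd t)) x + real (snd (snd t)) * \<eta> > 0)"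
        by (intro ball_cong refl) (auto simp: level_pattern_def)
      finally show "?pat x = P \<longleftrightarrow> (\<forall>t\<in>?A. (t \<in> P) =
        (quad d \<psi> (fst t) x - quad d \<psi> (fst (snd t)) x + real (snd (snd t)) * \<eta> > 0))" .
    qed
    also have "\<dots> \<in> sets (Leb d)"
      by (intro sets.sets_Collect_finite_All) auto
    finally show "{x\<in>space (Leb d). ?pat x = P} \<in> sets (Leb d)" .
  qed auto
  finally show ?thesis .
qed

text \<open>Outside the test set the point's own exponents are no witness for its pattern, so the
  first mixture is not larger. Inside, a witness with the same pattern limits how far the second can
  exceed the first. The pointwise form lets integration bound the L1 distance.\<close>

lemma test_set_dominates:
  assumes \<eta>: "\<eta> > 0" "exp (- (real L * \<eta>)) \<le> \<eta>" and k: "k > 0" and x: "x \<in> space (Leb d)"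
  shows "max 0 (expmix d k \<theta> x - expmix d k \<theta>' x)
    \<le> (expmix d k \<theta> x - expmix d k \<theta>' x) * indicator (test_set d k L \<eta> (join_params k \<theta> \<theta>')) x
      + 2 * real k * \<eta> * (expmix d k \<theta> x + expmix d k \<theta>' x)"
proof -
  define z where "z = (\<lambda>i. quad d (join_params k \<theta> \<theta>') i x)"
  have f: "expmix d k \<theta> x = (\<Sum>i<k. exp (z i))" "expmix d k \<theta>' x = (\<Sum>i<k. exp (z (i + k)))"
    by (simp_all add: expmix_def z_def quad_join_params)
  have nn: "0 \<le> expmix d k \<theta> x" "0 \<le> expmix d k \<theta>' x" by (simp_all add: expmix_def sum_nonneg)
  then have nn': "0 \<le> 2 * real k * \<eta> * (expmix d k \<theta> x + expmix d k \<theta>' x)" using \<eta> by simp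
  show ?thesis
  proof (cases "x \<in> test_set d k L \<eta> (join_params k \<theta> \<theta>')")
    case True
    then obtain z0 where z0: "level_pattern (2 * k) L \<eta> z0 = level_pattern (2 * k) L \<eta> z"
      "(\<Sum>i<k. exp (z0 i)) > (\<Sum>i<k. exp (z0 (i + k)))"
      by (auto simp: test_set_def good_pattern_def z_def)
    have "expmix d k \<theta>' x - expmix d k \<theta> x \<le> 2 * real k * \<eta> * (expmix d k \<theta> x + expmix d k \<theta>' x)"
      unfolding f by (rule level_pattern_compare[OF z0(1) \<eta> k z0(2)])
    then show ?thesis using True nn' by simp
  next
    case False
    then have "\<not> (\<Sum>i<k. exp (z i)) > (\<Sum>i<k. exp (z (i + k)))"
      using x by (auto simp: test_set_def good_pattern_def z_def)
    then show ?thesis using False nn' by (simp add: f)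
  qed
qed

text \<open>The trace of a test set is determined by the outcomes of all comparisons at all sample
  points. These outcomes form a half-space pattern in 2 k (d + 1)^2 + 1 coordinates, however
  complicated the test set is as a Boolean combination.\<close>

lemma test_set_growth:
  fixes z :: "nat \<Rightarrow> nat \<Rightarrow> real" and y :: real
  assumes z: "z \<in> {..<n} \<rightarrow> space (Leb d)" and y: "0 < y" "y \<le> 1"
  shows "real (card ((\<lambda>B. {s\<in>{..<n}. z s \<in> B}) ` (test_set d k L \<eta> ` \<Psi>)))
    \<le> exp (y * (real n * (2 * real k)\<^sup>2 * (real L + 1))) / y ^ (2 * k * (d + 1)\<^sup>2 + 1)"
proof -
  define J where "J = {..<n} \<times> {..<2 * k} \<times> {..<2 * k} \<times> {..L}"
  \<comment> \<open>The index \<open>None\<close> is a parameter frozen at 1 that carries the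
    threshold, turning affine inequalities into linear ones.\<close>
  define I where "I = insert None (Some ` ({..<2 * k} \<times> {..d} \<times> {..d}))"
  define u :: "nat \<times> nat \<times> nat \<times> nat \<Rightarrow> (nat \<times> nat \<times> nat) option \<Rightarrow> real" where "u = (\<lambda>(s, i, j, l) p. case p of None \<Rightarrow> real l * \<eta>
    | Some (i', a, b) \<Rightarrow> ((if i' = i then 1 else 0) - (if i' = j then 1 else 0)) * (hom_coord d (z s) a * hom_coord d (z s) b))"
  define ext :: "(nat \<times> nat \<times> nat \<Rightarrow> real) \<Rightarrow> (nat \<times> nat \<times> nat) option \<Rightarrow> real"
    where "ext = (\<lambda>\<psi> p. case p of None \<Rightarrow> 1 | Some q \<Rightarrow> (\<psi> q :: real))"
  define pats where "pats = (\<lambda>\<theta>. {t\<in>J. (\<Sum>p\<in>I. \<theta> p * u t p) > 0}) ` (ext ` \<Psi>)"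
  have sum: "(\<Sum>p\<in>I. ext \<psi> p * u (s, i, j, l) p) = quad d \<psi> i (z s) - quad d \<psi> j (z s) + real l * \<eta>"
    if "i < 2 * k" "j < 2 * k" for \<psi> s i j l
  proof -
    define h where "h = hom_coord d (z s)"
    have "(\<Sum>p\<in>I. ext \<psi> p * u (s, i, j, l) p) = real l * \<eta>
      + (\<Sum>q\<in>{..<2 * k} \<times> {..d} \<times> {..d}. ext \<psi> (Some q) * u (s, i, j, l) (Some q))"
      unfolding I_def by (subst sum.insert) (auto simp: ext_def u_def sum.reindex)
    also have "(\<Sum>q\<in>{..<2 * k} \<times> {..d} \<times> {..d}. ext \<psi> (Some q) * u (s, i, j, l) (Some q))
      = (\<Sum>i'<2 * k. \<Sum>a\<le>d. \<Sum>b\<le>d. \<psi> (i', a, b) * (((if i' = i then 1 else 0) - (if i' = j then 1 else 0)) * (h a * h b)))"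
      by (simp add: sum.cartesian_product ext_def u_def h_def case_prod_unfold)
    also have "\<dots> = (\<Sum>i'<2 * k. ((if i' = i then 1 else 0) - (if i' = j then 1 else 0)) * quad d \<psi> i' (z s))"
      unfolding quad_def h_def[symmetric] sum_distrib_left
      by (intro sum.cong refl) (simp add: mult_ac)
    also have "\<dots> = quad d \<psi> i (z s) - quad d \<psi> j (z s)"
      unfolding left_diff_distrib sum_subtractf using that by (simp add: sum_delta_mult)
    finally show ?thesis by simp
  qed
  \<comment> \<open>Decodes a trace from the set of satisfied comparisons, so there are at most as
    many traces as patterns.\<close>
  define \<Phi> where "\<Phi> = (\<lambda>A. {s\<in>{..<n}. good_pattern k L \<eta> {(i, j, l). (s, i, j, l) \<in> A}})"
  have tr: "{s\<in>{..<n}. z s \<in> test_set d k L \<eta> \<psi>} = \<Phi> {t\<in>J. (\<Sum>p\<in>I. ext \<psi> p * u t p) > 0}" for \<psi>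
  proof -
    have "level_pattern (2 * k) L \<eta> (\<lambda>i. quad d \<psi> i (z s)) = {(i, j, l). (s, i, j, l) \<in> {t\<in>J. (\<Sum>p\<in>I. ext \<psi> p * u t p) > 0}}"
      if "s < n" for s
      using that by (auto simp: level_pattern_def J_def sum)
    then show ?thesis using z by (auto simp: \<Phi>_def test_set_def Pi_iff)
  qed
  have fin: "finite I" "finite J" by (auto simp: I_def J_def)
  have finp: "finite pats" by (rule finite_subset[of _ "Pow J"]) (auto simp: pats_def fin)
  have "(\<lambda>B. {s\<in>{..<n}. z s \<in> B}) ` (test_set d k L \<eta> ` \<Psi>) = \<Phi> ` pats"
    unfolding pats_def image_image tr ..
  then have "card ((\<lambda>B. {s\<in>{..<n}. z s \<in> B}) ` (test_set d k L \<eta> ` \<Psi>)) \<le> card pats"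
    using card_image_le[OF finp] by simp
  also have "real (card pats) \<le> exp (y * card J) / y ^ card I"
    unfolding pats_def by (intro card_halfspace_patterns_le fin y)
  also have "real (card J) = real n * (2 * real k)\<^sup>2 * (real L + 1)"
    by (simp add: J_def power2_eq_square algebra_simps)
  also have "card I = 2 * k * (d + 1)\<^sup>2 + 1"
    unfolding I_def by (subst card_insert_disjoint) (auto simp: card_image power2_eq_square)
  finally show ?thesis by simp
qed

section \<open>Minimum distance estimation\<close>

text \<open>Scheffe's argument with surrogate sets: the two positive parts of f - h are integrated
  over B and B', where both densities are compared with the same numbers e and e'. Each replacement
  costs c times the integral of f + h, that is 2 c.\<close>

lemma min_distance_bound:
  fixes f h :: "'a \<Rightarrow> real"
  assumes int [simp]: "integrable M f" "integrable M h" and one: "integral\<^sup>L M f = 1" "integral\<^sup>L M h = 1"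
    and B [measurable]: "B \<in> sets M" "B' \<in> sets M"
    and dom: "\<And>x. x \<in> space M \<Longrightarrow> max 0 (f x - h x) \<le> (f x - h x) * indicator B x + c * (f x + h x)"
    and dom': "\<And>x. x \<in> space M \<Longrightarrow> max 0 (h x - f x) \<le> (h x - f x) * indicator B' x + c * (h x + f x)"
    and r: "\<bar>(\<integral>x. f x * indicator B x \<partial>M) - e\<bar> \<le> r" "\<bar>(\<integral>x. f x * indicator B' x \<partial>M) - e'\<bar> \<le> r"
    and r': "\<bar>(\<integral>x. h x * indicator B x \<partial>M) - e\<bar> \<le> r'" "\<bar>(\<integral>x. h x * indicator B' x \<partial>M) - e'\<bar> \<le> r'"
  shows "(\<integral>x. \<bar>f x - h x\<bar> \<partial>M) \<le> 2 * (r + r') + 4 * c"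
proof -
  have i: "integrable M (\<lambda>x. u x * indicator A x)" if "A \<in> sets M" "integrable M u" for A and u :: "'a \<Rightarrow> real"
    using integrable_mult_indicator[OF that] by (simp add: mult.commute)
  have "(\<integral>x. \<bar>f x - h x\<bar> \<partial>M) \<le> (\<integral>x. (f x * indicator B x - h x * indicator B x) +
      (h x * indicator B' x - f x * indicator B' x) + 2 * c * (f x + h x) \<partial>M)"
  proof (rule integral_mono)
    show "integrable M (\<lambda>x. (f x * indicator B x - h x * indicator B x) +
      (h x * indicator B' x - f x * indicator B' x) + 2 * c * (f x + h x))"
      using B by (intro Bochner_Integration.integrable_add Bochner_Integration.integrable_diff integrable_mult_right i int)
    fix x assume x: "x \<in> space M"
    have "\<bar>f x - h x\<bar> = max 0 (f x - h x) + max 0 (h x - f x)" by auto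
    also have "\<dots> \<le> (f x - h x) * indicator B x + c * (f x + h x) + ((h x - f x) * indicator B' x + c * (h x + f x))"
      by (intro add_mono dom dom' x)
    finally show "\<bar>f x - h x\<bar> \<le> (f x * indicator B x - h x * indicator B x) +
      (h x * indicator B' x - f x * indicator B' x) + 2 * c * (f x + h x)"
      by (simp add: algebra_simps)
  qed auto
  also have "\<dots> = ((\<integral>x. f x * indicator B x \<partial>M) - (\<integral>x. h x * indicator B x \<partial>M))
      + ((\<integral>x. h x * indicator B' x \<partial>M) - (\<integral>x. f x * indicator B' x \<partial>M)) + 4 * c"
    using i[OF B(1) int(1)] i[OF B(1) int(2)] i[OF B(2) int(1)] i[OF B(2) int(2)] by (simp add: one)
  also have "\<dots> \<le> (r + r') + (r + r') + 4 * c"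
  proof -
    have "a - b \<le> r + r'" if "\<bar>a - u\<bar> \<le> r" "\<bar>b - u\<bar> \<le> r'" for a b u using that by linarith
    moreover have "b - a \<le> r + r'" if "\<bar>a - u\<bar> \<le> r" "\<bar>b - u\<bar> \<le> r'" for a b u using that by linarith
    ultimately show ?thesis using r r' by (intro add_mono order.refl) blast+
  qed
  also have "\<dots> = 2 * (r + r') + 4 * c" by simp
  finally show ?thesis .
qed

lemma integral_indicator_diff_le:
  fixes f g :: "'a \<Rightarrow> real"
  assumes int: "integrable M f" "integrable M g" and B: "B \<in> sets M"
  shows "\<bar>(\<integral>x. f x * indicator B x \<partial>M) - (\<integral>x. g x * indicator B x \<partial>M)\<bar> \<le> (\<integral>x. \<bar>f x - g x\<bar> \<partial>M)"
proof -
  have i: "integrable M (\<lambda>x. u x * indicator B x)" if "integrable M u" for u :: "'a \<Rightarrow> real"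
    using integrable_mult_indicator[OF B that] by (simp add: mult.commute)
  have "(\<integral>x. f x * indicator B x \<partial>M) - (\<integral>x. g x * indicator B x \<partial>M) = (\<integral>x. (f x - g x) * indicator B x \<partial>M)"
    using i[OF int(1)] i[OF int(2)] by (simp add: left_diff_distrib)
  also have "\<bar>\<dots>\<bar> \<le> (\<integral>x. \<bar>(f x - g x) * indicator B x\<bar> \<partial>M)" by (rule integral_abs_bound)
  also have "\<dots> \<le> (\<integral>x. \<bar>f x - g x\<bar> \<partial>M)"
    using int by (intro integral_mono integrable_abs i Bochner_Integration.integrable_diff) (auto simp: indicator_def)
  finally show ?thesis .
qed

section \<open>Densities, their measures and L1 distances\<close>

lemma is_density_integrable:
  assumes "is_density d g"
  shows "integrable (Leb d) g" "integral\<^sup>L (Leb d) g = 1"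
proof -
  have g: "g \<in> borel_measurable (Leb d)" "AE x in Leb d. 0 \<le> g x" "(\<integral>\<^sup>+ x. ennreal (g x) \<partial>Leb d) = ennreal 1"
    using assms by (auto simp: is_density_def)
  show "integrable (Leb d) g" using g by (intro integrableI_nn_integral_finite)
  show "integral\<^sup>L (Leb d) g = 1" using g by (intro integral_eq_nn_integral[THEN trans]) auto
qed

lemma prob_space_density_Leb:
  assumes "is_density d g"
  shows "prob_space (density (Leb d) (\<lambda>x. ennreal (g x)))"
proof
  have "g \<in> borel_measurable (Leb d)" using assms by (simp add: is_density_def)
  then have "emeasure (density (Leb d) (\<lambda>x. ennreal (g x))) (space (Leb d)) = (\<integral>\<^sup>+ x. ennreal (g x) * indicator (space (Leb d)) x \<partial>Leb d)"
    by (intro emeasure_density) auto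
  also have "\<dots> = (\<integral>\<^sup>+ x. ennreal (g x) \<partial>Leb d)" by (intro nn_integral_cong) auto
  finally show "emeasure (density (Leb d) (\<lambda>x. ennreal (g x))) (space (density (Leb d) (\<lambda>x. ennreal (g x)))) = 1"
    using assms by (simp add: is_density_def)
qed

lemma measure_density_Leb:
  assumes g: "is_density d g" and B: "B \<in> sets (Leb d)"
  shows "measure (density (Leb d) (\<lambda>x. ennreal (g x))) B = (\<integral>x. g x * indicator B x \<partial>Leb d)"
proof -
  have gm: "g \<in> borel_measurable (Leb d)" and nn: "\<And>x. x \<in> space (Leb d) \<Longrightarrow> g x \<ge> 0"
    using g by (auto simp: is_density_def)
  have "emeasure (density (Leb d) (\<lambda>x. ennreal (g x))) B = (\<integral>\<^sup>+ x. ennreal (g x) * indicator B x \<partial>Leb d)"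
    using gm B by (intro emeasure_density) auto
  also have "\<dots> = (\<integral>\<^sup>+ x. ennreal (g x * indicator B x) \<partial>Leb d)"
    by (intro nn_integral_cong) (auto simp: indicator_def)
  also have "\<dots> = ennreal (\<integral>x. g x * indicator B x \<partial>Leb d)"
    using integrable_mult_indicator[OF B is_density_integrable(1)[OF g]] nn
    by (intro nn_integral_eq_integral) (auto simp: mult.commute intro!: AE_I2)
  finally show ?thesis
    using nn by (auto simp: measure_def intro!: integral_nonneg_AE AE_I2)
qed

lemma L1dist_eq_integral:
  assumes "integrable (Leb d) f" "integrable (Leb d) g"
  shows "L1dist d f g = ennreal (\<integral>x. \<bar>f x - g x\<bar> \<partial>Leb d)"
  unfolding L1dist_def using assms by (intro nn_integral_eq_integral) auto

text \<open>Makes \<open>opt\<close> finite and settles the case \<epsilon> >= 2.\<close>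

lemma L1dist_density_le_2:
  assumes f: "is_density d f" and g: "is_density d g"
  shows "L1dist d f g \<le> 2"
proof -
  have "L1dist d f g \<le> (\<integral>\<^sup>+ x. ennreal (f x) + ennreal (g x) \<partial>Leb d)"
    unfolding L1dist_def
  proof (intro nn_integral_mono)
    fix x assume "x \<in> space (Leb d)"
    then have "f x \<ge> 0" "g x \<ge> 0" using f g by (auto simp: is_density_def)
    then have "\<bar>f x - g x\<bar> \<le> f x + g x" "ennreal (f x + g x) = ennreal (f x) + ennreal (g x)"
      by auto
    then show "ennreal \<bar>f x - g x\<bar> \<le> ennreal (f x) + ennreal (g x)"
      using ennreal_leI by metis
  qed
  also have "\<dots> = (\<integral>\<^sup>+ x. ennreal (f x) \<partial>Leb d) + (\<integral>\<^sup>+ x. ennreal (g x) \<partial>Leb d)"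
    using f g by (intro nn_integral_add) (auto simp: is_density_def)
  also have "\<dots> = 2" using f g by (simp add: is_density_def)
  finally show ?thesis .
qed

lemma mixtures_nonempty:
  assumes "k \<ge> 1"
  shows "mixtures d k \<noteq> {}"
proof -
  define I where "I = (\<lambda>i j :: nat. if i = j then 1 else 0 :: real)"
  have "0 < qform d I v" if nz: "\<exists>i<d. v i \<noteq> 0" for v
  proof -
    obtain i where i: "i < d" "v i \<noteq> 0" using nz by auto
    have "qform d I v = (\<Sum>i<d. v i * v i)"
      unfolding I_def mult.assoc sum_distrib_left[symmetric] by (intro sum.cong refl) (simp add: sum_delta_mult)
    also have "0 < \<dots>" using i by (intro sum_pos2[of _ i]) (auto simp: zero_less_mult_iff)
    finally show ?thesis .
  qed
  then have I: "pos_def d I" by (auto simp: pos_def_def I_def)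
  have "(\<Sum>i<k. (if i = 0 then 1 else 0 :: real)) = 1" using assms by simp
  then show ?thesis
    unfolding mixtures_def using I
    by (auto intro!: exI[of _ "\<lambda>i. if i = 0 then 1 else 0"] exI[of _ "\<lambda>_. I"])
qed

text \<open>Origin of y: a double sample of size 2 n has at most 6144 n k^4 / \<epsilon>^2
  comparisons, against a deviation exponent of n \<epsilon>^2 / 3872, so y must be of order
  \<epsilon>^4 / k^4. The rest of the exponent has to cover p * ln (1 / y) and ln (4 /
  \<delta>).\<close>

lemma sample_size_sufficient:
  fixes \<epsilon> \<delta> :: real and k d n :: nat
  assumes kd: "k \<ge> 1" "d \<ge> 1" and \<epsilon>: "0 < \<epsilon>" "\<epsilon> < 2" and \<delta>: "0 < \<delta>" "\<delta> < 1"
    and n: "real n \<ge> 10 ^ 7 * real k * real d ^ 2 * (1 + ln (real k)) * (1 + ln (real k / \<delta>)) / \<epsilon> ^ 4"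
  defines "\<eta> \<equiv> \<epsilon> / (16 * real k)"
  defines "L \<equiv> nat \<lceil>1 / \<eta>\<^sup>2\<rceil>"
  defines "y \<equiv> \<epsilon> ^ 4 / (10 ^ 8 * real k ^ 4)"
  defines "G \<equiv> exp (y * (real (2 * n) * (2 * real k)\<^sup>2 * (real L + 1))) / y ^ (2 * k * (d + 1)\<^sup>2 + 1)"
  shows "\<eta> > 0" "exp (- (real L * \<eta>)) \<le> \<eta>" "0 < y" "y \<le> 1" "n > 0"
    "real n * (\<epsilon> / 22)\<^sup>2 \<ge> 4" "4 * G * exp (- (n * (\<epsilon> / 22)\<^sup>2 / 8)) \<le> \<delta>"
proof -
  define K where "K = real k"
  define v where "v = K * real d ^ 2"
  define lk where "lk = 1 + ln K"
  define ld where "ld = 1 + ln (K / \<delta>)"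
  have K: "K \<ge> 1" using kd by (simp add: K_def)
  have dd: "real d ^ 2 \<ge> 1" using kd by simp
  have v: "v \<ge> 1" using mult_mono[OF K dd] K by (simp add: v_def)
  have lk: "lk \<ge> 1" using K by (simp add: lk_def)
  have ld: "ld \<ge> 1 - ln \<delta>" using K \<delta> by (simp add: ld_def ln_div)
  have l\<delta>: "ln \<delta> \<le> 0" using \<delta> by simp
  have ld1: "ld \<ge> 1" using ld l\<delta> by simp
  have e4: "\<epsilon>\<^sup>2 \<le> 4" using power_mono[of \<epsilon> 2 2] \<epsilon> by simp
  \<comment> \<open>From \<epsilon> < 2; this is how additive constants are absorbed into multiples
    of 1 / \<epsilon>^2.\<close>
  have ie: "1 \<le> 4 / \<epsilon>\<^sup>2" using e4 \<epsilon> by (simp add: field_simps)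
  have vlk: "v * lk \<ge> 1" using mult_mono[OF v lk] v by simp
  have vll: "v * lk * ld \<ge> 1" "v * lk \<le> v * lk * ld" "ld \<le> v * lk * ld"
    using mult_mono[OF vlk ld1] mult_left_mono[OF ld1, of "v * lk"] mult_right_mono[OF vlk, of ld] vlk ld1 by auto
  show \<eta>: "\<eta> > 0" using \<epsilon> K by (simp add: \<eta>_def K_def)
  have \<eta>1: "\<eta> \<le> 1"
    using \<epsilon> K by (simp add: \<eta>_def K_def[symmetric] divide_le_eq)
  have L: "1 / \<eta>\<^sup>2 \<le> real L" "real L \<le> 1 / \<eta>\<^sup>2 + 1"
    unfolding L_def using \<eta> by (simp_all add: of_nat_ceiling) 
  show "exp (- (real L * \<eta>)) \<le> \<eta>"
  proof -
    \<comment> \<open>About 1 / \<eta>^2 levels allow the crude bound exp u >= u; the number of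
      levels affects the sample size only logarithmically, through y.\<close>
    have "1 / \<eta> = 1 / \<eta>\<^sup>2 * \<eta>" using \<eta> by (simp add: power2_eq_square)
    also have "\<dots> \<le> real L * \<eta>" using L \<eta> by (intro mult_right_mono) auto
    also have "\<dots> \<le> exp (real L * \<eta>)" using exp_ge_add_one_self[of "real L * \<eta>"] by linarith
    finally have "1 / \<eta> \<le> exp (real L * \<eta>)" .
    then show ?thesis using \<eta> by (simp add: exp_minus field_simps)
  qed
  show y: "0 < y" using \<epsilon> K by (simp add: y_def K_def[symmetric])
  show "y \<le> 1"
  proof -
    have "\<epsilon> ^ 4 \<le> 2 ^ 4" using \<epsilon> by (intro power_mono) auto
    also have "\<dots> \<le> 10 ^ 8 * 1" by simp
    also have "\<dots> \<le> 10 ^ 8 * K ^ 4" using K by (intro mult_left_mono one_le_power) auto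
    finally show ?thesis using K by (simp add: y_def K_def[symmetric] divide_le_eq)
  qed
  define W where "W = n * \<epsilon>\<^sup>2"
  have W: "W \<ge> 10 ^ 7 * (v * lk * ld / \<epsilon>\<^sup>2)"
  proof -
    have "10 ^ 7 * (v * lk * ld / \<epsilon>\<^sup>2) = (10 ^ 7 * real k * real d ^ 2 * (1 + ln (real k)) * (1 + ln (real k / \<delta>)) / \<epsilon> ^ 4) * \<epsilon>\<^sup>2"
      using \<epsilon> by (simp add: v_def lk_def ld_def K_def power2_eq_square power4_eq_xxxx)
    also have "\<dots> \<le> W" unfolding W_def using n by (intro mult_right_mono) auto
    finally show ?thesis .
  qed
  have X: "v * lk * ld / \<epsilon>\<^sup>2 \<ge> 1 / 4"
  proof -
    have "1 / 4 \<le> 1 / \<epsilon>\<^sup>2" using ie by simp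
    also have "\<dots> \<le> v * lk * ld / \<epsilon>\<^sup>2" using vll by (intro divide_right_mono) auto
    finally show ?thesis .
  qed
  have "W > 0" using W X by simp
  then show n0: "n > 0" by (auto simp: W_def intro: gr0I)
  have W': "n * (\<epsilon> / 22)\<^sup>2 = W / 484" by (simp add: W_def power_divide)
  show "real n * (\<epsilon> / 22)\<^sup>2 \<ge> 4" unfolding W' using W X by simp
  define p where "p = 2 * k * (d + 1)\<^sup>2 + 1"
  define Q where "Q = y * (real (2 * n) * (2 * real k)\<^sup>2 * (real L + 1))"
  \<comment> \<open>A quarter of the deviation exponent W / 484 / 8.\<close>
  have Q: "Q \<le> W / 484 / 32"
  proof -
    have "1 \<le> 1 / \<eta>\<^sup>2" using \<eta> \<eta>1 by (simp add: power_le_one)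
    then have "real L + 1 \<le> 3 / \<eta>\<^sup>2" using L(2) by simp
    also have "\<dots> = 768 * K ^ 2 / \<epsilon>\<^sup>2" using \<epsilon> K by (simp add: \<eta>_def K_def[symmetric] power_divide power_mult_distrib)
    finally have "Q \<le> y * (real (2 * n) * (2 * K)\<^sup>2 * (768 * K ^ 2 / \<epsilon>\<^sup>2))"
      unfolding Q_def K_def[symmetric] using y by (intro mult_left_mono) auto
    also have "\<dots> = 6144 / 10 ^ 8 * W"
      using K \<epsilon> by (simp add: y_def W_def K_def[symmetric] power_mult_distrib power2_eq_square power4_eq_xxxx)
    also have "\<dots> \<le> W / 484 / 32" using \<open>W > 0\<close> by simp
    finally show ?thesis .
  qed
  have p: "real p \<le> 9 * v"
  proof -
    have "real (d + 1) ^ 2 \<le> (2 * real d) ^ 2" using kd by (intro power_mono) auto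
    then have "2 * K * real (d + 1) ^ 2 \<le> 2 * K * (4 * real d ^ 2)"
      using K by (intro mult_left_mono) (auto simp: power_mult_distrib)
    then show ?thesis using v by (simp add: p_def v_def K_def)
  qed
  have ly: "ln (1 / y) \<le> 110 * lk / \<epsilon>\<^sup>2"
  proof -
    have "ln (1 / y) = ln (10 ^ 8) + 4 * ln K + 2 * ln (1 / \<epsilon>\<^sup>2)"
      using K \<epsilon> by (simp add: y_def K_def[symmetric] ln_div ln_mult ln_realpow)
    also have "ln (10 ^ 8 :: real) \<le> ln (2 ^ 27)" by (subst ln_le_cancel_iff) auto
    also have "ln (2 ^ 27 :: real) = 27 * ln 2" using ln_realpow[of "2::real" 27] by (simp only: of_nat_numeral)
    also have "27 * ln 2 \<le> (27 :: real)" using ln_le_minus_one[of "2::real"] by simp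
    \<comment> \<open>Trading the logarithm for a power raises the dependence from 1 / \<epsilon>^2
      to 1 / \<epsilon>^4.\<close>
    also have "ln (1 / \<epsilon>\<^sup>2) \<le> 1 / \<epsilon>\<^sup>2" using ln_bound[of "1 / \<epsilon>\<^sup>2"] \<epsilon> by simp
    finally have "ln (1 / y) \<le> 27 * 1 + 4 * ln K * 1 + 2 * (1 / \<epsilon>\<^sup>2)" by simp
    also have "\<dots> \<le> 27 * (4 / \<epsilon>\<^sup>2) + 4 * ln K * (4 / \<epsilon>\<^sup>2) + 2 * (1 / \<epsilon>\<^sup>2)"
      using ie K by (intro add_mono mult_left_mono) auto
    also have "\<dots> = (110 + 16 * ln K) / \<epsilon>\<^sup>2" by (simp add: add_divide_distrib)
    also have "\<dots> \<le> 110 * lk / \<epsilon>\<^sup>2" using K by (intro divide_right_mono) (auto simp: lk_def)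
    finally show ?thesis .
  qed
  have ply: "p * ln (1 / y) \<le> 990 * (v * lk * ld / \<epsilon>\<^sup>2)"
  proof -
    have "p * ln (1 / y) \<le> (9 * v) * (110 * lk / \<epsilon>\<^sup>2)"
      using p ly v lk by (intro mult_mono) (auto simp: y \<open>y \<le> 1\<close>)
    also have "\<dots> = 990 * (v * lk / \<epsilon>\<^sup>2)" by simp
    also have "\<dots> \<le> 990 * (v * lk * ld / \<epsilon>\<^sup>2)"
      using vll by (intro mult_left_mono divide_right_mono) auto
    finally show ?thesis .
  qed
  have l4: "ln 4 - ln \<delta> \<le> 12 * (v * lk * ld / \<epsilon>\<^sup>2)"
  proof -
    have "ln 4 \<le> (3 :: real)" using ln_le_minus_one[of "4::real"] by simp
    then have "ln 4 - ln \<delta> \<le> 3 * ld * 1" using ld l\<delta> by simp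
    also have "\<dots> \<le> 3 * ld * (4 / \<epsilon>\<^sup>2)" using ie ld1 by (intro mult_left_mono) auto
    also have "\<dots> = 12 * (ld / \<epsilon>\<^sup>2)" by simp
    also have "\<dots> \<le> 12 * (v * lk * ld / \<epsilon>\<^sup>2)" using vll by (intro mult_left_mono divide_right_mono) auto
    finally show ?thesis .
  qed
  have "4 * G * exp (- (n * (\<epsilon> / 22)\<^sup>2 / 8)) = exp (ln 4 + Q + p * ln (1 / y) - W / 484 / 8)"
  proof -
    have "inverse (y ^ p) = exp (p * ln (1 / y))"
      using y by (simp add: ln_div exp_minus exp_of_nat_mult)
    then have "G = exp (Q + p * ln (1 / y))"
      unfolding G_def Q_def[symmetric] p_def[symmetric] by (simp only: divide_inverse exp_add)
    then have "4 * G * exp (- (n * (\<epsilon> / 22)\<^sup>2 / 8)) = exp (ln 4) * exp (Q + p * ln (1 / y)) * exp (- (W / 484 / 8))"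
      unfolding W' by simp
    also have "\<dots> = exp (ln 4 + Q + p * ln (1 / y) - W / 484 / 8)"
      unfolding mult_exp_exp by (intro arg_cong[where f = exp]) linarith
    finally show ?thesis .
  qed
  also have "\<dots> \<le> exp (ln \<delta>)"
  proof -
    \<comment> \<open>After Q has taken its quarter, the remaining exponent is at least 1900 X,
      while 990 X + 12 X has to be covered.\<close>
    define X where "X = v * lk * ld / \<epsilon>\<^sup>2"
    have "a + Q + b - W / 484 / 8 \<le> c" if "b \<le> 990 * X" "a - c \<le> 12 * X" for a b c
    proof -
      have "10000000 * X \<le> W" "1 / 4 \<le> X" using W X by (simp_all add: X_def)
      then show ?thesis using Q that by (simp add: algebra_simps)
    qed
    then have "ln 4 + Q + p * ln (1 / y) - W / 484 / 8 \<le> ln \<delta>"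
      using ply l4 unfolding X_def .
    then show ?thesis by simp
  qed
  also have "\<dots> = \<delta>" using \<delta> by simp
  finally show "4 * G * exp (- (n * (\<epsilon> / 22)\<^sup>2 / 8)) \<le> \<delta>" .
qed

text \<open>Confines the randomness to one event: on it the empirical frequencies of all test sets
  are accurate, and the analysis of the estimator is deterministic.\<close>

lemma uniform_frequency_event:
  fixes \<epsilon> \<delta> :: real and T :: "(nat \<times> nat \<times> nat \<Rightarrow> real) set"
  assumes kd: "k \<ge> 1" "d \<ge> 1" and \<epsilon>: "0 < \<epsilon>" "\<epsilon> < 2" and \<delta>: "0 < \<delta>" "\<delta> < 1"
    and n: "real n \<ge> 10 ^ 7 * real k * real d ^ 2 * (1 + ln (real k)) * (1 + ln (real k / \<delta>)) / \<epsilon> ^ 4"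
    and g: "is_density d g" and T: "countable T"
  defines "\<eta> \<equiv> \<epsilon> / (16 * real k)"
  defines "L \<equiv> nat \<lceil>1 / \<eta>\<^sup>2\<rceil>"
  shows "\<exists>E\<in>sets (sample_space d n g). measure (sample_space d n g) E \<ge> 1 - \<delta> \<and>
    (\<forall>S\<in>E. \<forall>\<psi>\<in>T. \<bar>(\<integral>x. g x * indicator (test_set d k L \<eta> \<psi>) x \<partial>Leb d)
      - (\<Sum>i<n. indicator (test_set d k L \<eta> \<psi>) (S i)) / n\<bar> \<le> \<epsilon> / 22)"
proof -
  define P where "P = density (Leb d) (\<lambda>x. ennreal (g x))"
  define N where "N = PiM {..<n} (\<lambda>_. P)"
  define \<B> where "\<B> = test_set d k L \<eta> ` T"
  define y where "y = \<epsilon> ^ 4 / (10 ^ 8 * real k ^ 4)"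
  define G where "G = exp (y * (real (2 * n) * (2 * real k)\<^sup>2 * (real L + 1))) / y ^ (2 * k * (d + 1)\<^sup>2 + 1)"
  note suff = sample_size_sufficient[OF kd \<epsilon> \<delta> n, folded \<eta>_def, folded L_def, folded y_def, folded G_def]
  interpret P: prob_space P unfolding P_def by (rule prob_space_density_Leb[OF g])
  interpret N: prob_space N unfolding N_def by (intro prob_space_PiM P.prob_space_axioms)
  have NS: "N = sample_space d n g" by (simp add: N_def sample_space_def P_def)
  have sp: "space P = space (Leb d)" "sets P = sets (Leb d)" by (simp_all add: P_def)
  define bad where "bad = {z\<in>space N. \<exists>B\<in>\<B>. \<bar>(\<Sum>i<n. indicator B (z i)) - n * P.prob B\<bar> > n * (\<epsilon> / 22)}"
  have cnt: "countable \<B>" using T by (simp add: \<B>_def)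
  have sub: "\<B> \<subseteq> sets P" by (auto simp: \<B>_def sp)
  have "N.prob bad \<le> 4 * G * exp (- (n * (\<epsilon> / 22)\<^sup>2 / 8))"
    unfolding bad_def N_def
  proof (rule P.vc_uniform_deviation[OF cnt sub])
    fix z assume "z \<in> {..<2 * n} \<rightarrow> space P"
    then show "real (card ((\<lambda>B. {i \<in> {..<2 * n}. z i \<in> B}) ` \<B>)) \<le> G"
      unfolding G_def \<B>_def using suff by (intro test_set_growth) (auto simp: sp)
  qed (use suff \<epsilon> in auto)
  also have "\<dots> \<le> \<delta>" by (rule suff(7))
  finally have prob_bad: "N.prob bad \<le> \<delta>" .
  have "bad = (\<Union>B\<in>\<B>. {z\<in>space N. \<bar>(\<Sum>i<n. indicator B (z i)) - n * P.prob B\<bar> > n * (\<epsilon> / 22)})"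
    by (auto simp: bad_def)
  also have "\<dots> \<in> sets N"
  proof (intro sets.countable_UN'' cnt)
    fix B assume B: "B \<in> \<B>"
    have [measurable]: "(\<lambda>z. (\<Sum>i<n. indicator B (z i)) :: real) \<in> borel_measurable N"
      using B sub unfolding N_def
      by (intro borel_measurable_sum measurable_compose[OF measurable_component_singleton] borel_measurable_indicator) auto
    show "{z\<in>space N. \<bar>(\<Sum>i<n. indicator B (z i)) - n * P.prob B\<bar> > n * (\<epsilon> / 22)} \<in> sets N"
      by measurable
  qed
  finally have bad: "bad \<in> sets N" .
  show ?thesis
  proof (intro bexI conjI ballI)
    show "space N - bad \<in> sets (sample_space d n g)" using bad by (simp add: NS[symmetric])
    show "1 - \<delta> \<le> measure (sample_space d n g) (space N - bad)"
      unfolding NS[symmetric] using N.prob_compl[OF bad] prob_bad by simp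
  next
    fix S \<psi> assume S: "S \<in> space N - bad" and \<psi>: "\<psi> \<in> T"
    define B where "B = test_set d k L \<eta> \<psi>"
    have "B \<in> \<B>" using \<psi> by (simp add: B_def \<B>_def)
    then have "\<bar>(\<Sum>i<n. indicator B (S i)) - n * P.prob B\<bar> \<le> n * (\<epsilon> / 22)"
      using S by (auto simp: bad_def)
    then have "\<bar>(\<Sum>i<n. indicator B (S i)) - n * P.prob B\<bar> / n \<le> \<epsilon> / 22"
      using suff(5) by (simp add: field_simps)
    also have "\<bar>(\<Sum>i<n. indicator B (S i)) - n * P.prob B\<bar> / n = \<bar>((\<Sum>i<n. indicator B (S i)) - n * P.prob B) / n\<bar>"
      by simp
    also have "((\<Sum>i<n. indicator B (S i)) - n * P.prob B) / n = (\<Sum>i<n. indicator B (S i)) / n - P.prob B"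
      using suff(5) by (simp add: field_simps)
    finally show "\<bar>(\<integral>x. g x * indicator (test_set d k L \<eta> \<psi>) x \<partial>Leb d)
      - (\<Sum>i<n. indicator (test_set d k L \<eta> \<psi>) (S i)) / n\<bar> \<le> \<epsilon> / 22"
      using measure_density_Leb[OF g test_set_sets, of k L \<eta> \<psi>]
      by (simp add: B_def P_def abs_minus_commute)
  qed
qed

text \<open>A predicate in the radius r instead of a supremum over test sets, which would need
  boundedness to be meaningful over the reals.\<close>

definition fits_frequencies ::
  "nat \<Rightarrow> nat \<Rightarrow> nat \<Rightarrow> real \<Rightarrow> (nat \<times> nat \<times> nat \<Rightarrow> real) set \<Rightarrow> (nat \<Rightarrow> nat \<Rightarrow> real) \<Rightarrow> nat
    \<Rightarrow> (nat \<times> nat \<times> nat \<Rightarrow> real) \<Rightarrow> real \<Rightarrow> bool" where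
  "fits_frequencies d k L \<eta> T S n \<tau> r \<longleftrightarrow> (\<forall>\<sigma>\<in>T. \<forall>\<sigma>'\<in>T.
     \<bar>(\<integral>x. expmix d k \<tau> x * indicator (test_set d k L \<eta> (join_params k \<sigma> \<sigma>')) x \<partial>Leb d)
      - (\<Sum>i<n. indicator (test_set d k L \<eta> (join_params k \<sigma> \<sigma>')) (S i)) / n\<bar> \<le> r)"

text \<open>The best radius over an infinite set of candidates need not be attained, hence a
  minimizer up to the slack \<alpha>. Only the sample and known parameters enter, never g.\<close>

definition min_distance_choice ::
  "nat \<Rightarrow> nat \<Rightarrow> nat \<Rightarrow> real \<Rightarrow> (nat \<times> nat \<times> nat \<Rightarrow> real) set \<Rightarrow> (nat \<Rightarrow> nat \<Rightarrow> real) \<Rightarrow> nat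
    \<Rightarrow> real \<Rightarrow> (nat \<times> nat \<times> nat \<Rightarrow> real)" where
  "min_distance_choice d k L \<eta> T S n \<alpha> = (SOME \<tau>. \<tau> \<in> T \<and> (\<exists>r. fits_frequencies d k L \<eta> T S n \<tau> r \<and>
     (\<forall>\<tau>'\<in>T. \<forall>r'. fits_frequencies d k L \<eta> T S n \<tau>' r' \<longrightarrow> r \<le> r' + \<alpha>)))"

lemma min_distance_choice:
  assumes fit: "\<tau>0 \<in> T" "fits_frequencies d k L \<eta> T S n \<tau>0 r0" and \<alpha>: "\<alpha> > 0"
  defines "\<tau> \<equiv> min_distance_choice d k L \<eta> T S n \<alpha>"
  shows "\<tau> \<in> T" "fits_frequencies d k L \<eta> T S n \<tau> (r0 + \<alpha>)"
proof -
  define R where "R = {r. \<exists>\<tau>\<in>T. fits_frequencies d k L \<eta> T S n \<tau> r}"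
  have nn: "r \<ge> 0" if "r \<in> R" for r
    using that fit(1) by (auto simp: R_def fits_frequencies_def intro: order.trans[OF abs_ge_zero])
  then have bdd: "bdd_below R" by (intro bdd_belowI)
  have "r0 \<in> R" using fit by (auto simp: R_def)
  then have "\<exists>r\<in>R. r < Inf R + \<alpha>" using \<alpha> by (intro cInf_lessD) auto
  then obtain r \<tau>1 where r: "\<tau>1 \<in> T" "fits_frequencies d k L \<eta> T S n \<tau>1 r" "r < Inf R + \<alpha>"
    by (auto simp: R_def)
  have "r \<le> r' + \<alpha>" if "r' \<in> R" for r' using cInf_lower[OF that bdd] r(3) by linarith
  then have "\<exists>\<tau>. \<tau> \<in> T \<and> (\<exists>r. fits_frequencies d k L \<eta> T S n \<tau> r \<and>
     (\<forall>\<tau>'\<in>T. \<forall>r'. fits_frequencies d k L \<eta> T S n \<tau>' r' \<longrightarrow> r \<le> r' + \<alpha>))"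
    using r(1,2) by (auto simp: R_def)
  from someI_ex[OF this] obtain r where "\<tau> \<in> T" "fits_frequencies d k L \<eta> T S n \<tau> r" "r \<le> r0 + \<alpha>"
    using fit by (auto simp: \<tau>_def min_distance_choice_def)
  then show "\<tau> \<in> T" "fits_frequencies d k L \<eta> T S n \<tau> (r0 + \<alpha>)"
    unfolding fits_frequencies_def by (auto intro: order.trans)
qed

text \<open>Let D be the distance from g to a nearly optimal candidate. This candidate fits the
  frequencies within D + \<alpha> and the chosen one within D + 2 \<alpha>. The surrogate Scheffe
  bound puts them at distance at most 4 D + 6 \<alpha> + \<epsilon> / 2, and the triangle inequality
  through the first adds another D.\<close>

lemma min_distance_agnostic:
  fixes \<epsilon> :: real and T :: "(nat \<times> nat \<times> nat \<Rightarrow> real) set"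
  assumes k: "k \<ge> 1" and \<epsilon>: "0 < \<epsilon>" and g: "is_density d g"
    and T: "\<And>\<tau>. \<tau> \<in> T \<Longrightarrow> expmix d k \<tau> \<in> mixtures d k"
    and dense: "\<And>f \<eta>. f \<in> mixtures d k \<Longrightarrow> \<eta> > 0 \<Longrightarrow> \<exists>\<tau>\<in>T. L1dist d (expmix d k \<tau>) f \<le> ennreal \<eta>"
    and \<eta>: "\<eta> = \<epsilon> / (16 * real k)" "exp (- (real L * \<eta>)) \<le> \<eta>"
    and S: "\<And>\<sigma> \<sigma>'. \<sigma> \<in> T \<Longrightarrow> \<sigma>' \<in> T \<Longrightarrow>
      \<bar>(\<integral>x. g x * indicator (test_set d k L \<eta> (join_params k \<sigma> \<sigma>')) x \<partial>Leb d)
      - (\<Sum>i<n. indicator (test_set d k L \<eta> (join_params k \<sigma> \<sigma>')) (S i)) / n\<bar> \<le> \<epsilon> / 22"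
  shows "L1dist d (expmix d k (min_distance_choice d k L \<eta> T S n (\<epsilon> / 22))) g
    \<le> 9 * opt d (mixtures d k) g + ennreal \<epsilon>"
proof -
  define \<alpha> where "\<alpha> = \<epsilon> / 22"
  have \<alpha>: "\<alpha> > 0" using \<epsilon> by (simp add: \<alpha>_def)
  have \<eta>0: "\<eta> > 0" using \<epsilon> k \<eta>(1) by simp
  have dens: "is_density d (expmix d k \<tau>)" if "\<tau> \<in> T" for \<tau> using mixtures_density T that by blast
  note int = is_density_integrable
  have ig: "integrable (Leb d) g" by (rule int[OF g])
  define o' where "o' = enn2real (opt d (mixtures d k) g)"
  have "opt d (mixtures d k) g \<le> 2"
  proof -
    obtain f where f: "f \<in> mixtures d k" using mixtures_nonempty[OF k] by blast
    have "opt d (mixtures d k) g \<le> L1dist d f g" unfolding opt_def using f by (rule INF_lower)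
    also have "\<dots> \<le> 2" by (intro L1dist_density_le_2 mixtures_density(1)[OF f] g)
    finally show ?thesis .
  qed
  then have "opt d (mixtures d k) g < \<top>" by (rule order.strict_trans1) simp
  then have o': "opt d (mixtures d k) g = ennreal o'" "o' \<ge> 0" by (simp_all add: o'_def)
  obtain \<tau>0 where \<tau>0: "\<tau>0 \<in> T" "(\<integral>x. \<bar>expmix d k \<tau>0 x - g x\<bar> \<partial>Leb d) \<le> o' + \<alpha>"
  proof -
    \<comment> \<open>The infimum may not be attained, and a nearly optimal mixture may lie outside
      T; half of \<alpha> is spent on each.\<close>
    have "(INF f\<in>mixtures d k. L1dist d f g) < ennreal (o' + \<alpha> / 2)"
      using o' \<alpha> unfolding opt_def[symmetric] by (simp add: ennreal_less_iff)
    then obtain f where f: "f \<in> mixtures d k" "L1dist d f g < ennreal (o' + \<alpha> / 2)"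
      by (auto simp: INF_less_iff)
    obtain \<tau> where \<tau>: "\<tau> \<in> T" "L1dist d (expmix d k \<tau>) f \<le> ennreal (\<alpha> / 2)"
      using dense[OF f(1), of "\<alpha> / 2"] \<alpha> by auto
    note if' = int(1)[OF mixtures_density(1)[OF f(1)]] and it = int(1)[OF dens[OF \<tau>(1)]]
    have 1: "(\<integral>x. \<bar>f x - g x\<bar> \<partial>Leb d) \<le> o' + \<alpha> / 2"
      using f(2) o' \<alpha> unfolding L1dist_eq_integral[OF if' ig]
      by (subst (asm) ennreal_less_iff) (auto intro!: integral_nonneg_AE)
    have 2: "(\<integral>x. \<bar>expmix d k \<tau> x - f x\<bar> \<partial>Leb d) \<le> \<alpha> / 2"
      using \<tau>(2) \<alpha> unfolding L1dist_eq_integral[OF it if']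
      by (subst (asm) ennreal_le_iff) auto
    have "(\<integral>x. \<bar>expmix d k \<tau> x - g x\<bar> \<partial>Leb d) \<le> (\<integral>x. \<bar>expmix d k \<tau> x - f x\<bar> + \<bar>f x - g x\<bar> \<partial>Leb d)"
      using if' it ig by (intro integral_mono) auto
    also have "\<dots> = (\<integral>x. \<bar>expmix d k \<tau> x - f x\<bar> \<partial>Leb d) + (\<integral>x. \<bar>f x - g x\<bar> \<partial>Leb d)"
      using if' it ig by (intro Bochner_Integration.integral_add) auto
    finally show thesis using 1 2 \<tau>(1) that by fastforce
  qed
  define D where "D = (\<integral>x. \<bar>expmix d k \<tau>0 x - g x\<bar> \<partial>Leb d)"
  have fit0: "fits_frequencies d k L \<eta> T S n \<tau>0 (D + \<alpha>)"
    unfolding fits_frequencies_def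
  proof (intro ballI)
    fix \<sigma> \<sigma>' assume s: "\<sigma> \<in> T" "\<sigma>' \<in> T"
    define B where "B = test_set d k L \<eta> (join_params k \<sigma> \<sigma>')"
    have "\<bar>(\<integral>x. expmix d k \<tau>0 x * indicator B x \<partial>Leb d) - (\<integral>x. g x * indicator B x \<partial>Leb d)\<bar> \<le> D"
      unfolding D_def by (intro integral_indicator_diff_le int(1) dens \<tau>0 g) (simp add: B_def)
    moreover have "\<bar>(\<integral>x. g x * indicator B x \<partial>Leb d) - (\<Sum>i<n. indicator B (S i)) / n\<bar> \<le> \<alpha>"
      using S[OF s] by (simp only: B_def \<alpha>_def)
    ultimately have "\<bar>(\<integral>x. expmix d k \<tau>0 x * indicator B x \<partial>Leb d) - (\<Sum>i<n. indicator B (S i)) / n\<bar> \<le> D + \<alpha>"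
      by linarith
    then show "\<bar>(\<integral>x. expmix d k \<tau>0 x * indicator (test_set d k L \<eta> (join_params k \<sigma> \<sigma>')) x \<partial>Leb d)
      - (\<Sum>i<n. indicator (test_set d k L \<eta> (join_params k \<sigma> \<sigma>')) (S i)) / n\<bar> \<le> D + \<alpha>"
      by (simp only: B_def)
  qed
  define \<tau> where "\<tau> = min_distance_choice d k L \<eta> T S n \<alpha>"
  have \<tau>: "\<tau> \<in> T" and fit: "fits_frequencies d k L \<eta> T S n \<tau> (D + \<alpha> + \<alpha>)"
    using min_distance_choice[OF \<tau>0(1) fit0 \<alpha>] by (simp_all add: \<tau>_def)
  define B where "B = test_set d k L \<eta> (join_params k \<tau>0 \<tau>)"
  define B' where "B' = test_set d k L \<eta> (join_params k \<tau> \<tau>0)"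
  have k0: "k > 0" using k by simp
  have "(\<integral>x. \<bar>expmix d k \<tau>0 x - expmix d k \<tau> x\<bar> \<partial>Leb d) \<le> 2 * ((D + \<alpha>) + (D + \<alpha> + \<alpha>)) + 4 * (2 * real k * \<eta>)"
  proof (rule min_distance_bound[where B = B and B' = B' and e = "(\<Sum>i<n. indicator B (S i)) / n" and e' = "(\<Sum>i<n. indicator B' (S i)) / n"])
    show "max 0 (expmix d k \<tau>0 x - expmix d k \<tau> x) \<le> (expmix d k \<tau>0 x - expmix d k \<tau> x) * indicator B x
        + 2 * real k * \<eta> * (expmix d k \<tau>0 x + expmix d k \<tau> x)" if "x \<in> space (Leb d)" for x
      unfolding B_def by (rule test_set_dominates[OF \<eta>0 \<eta>(2) k0 that])
    show "max 0 (expmix d k \<tau> x - expmix d k \<tau>0 x) \<le> (expmix d k \<tau> x - expmix d k \<tau>0 x) * indicator B' x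
        + 2 * real k * \<eta> * (expmix d k \<tau> x + expmix d k \<tau>0 x)" if "x \<in> space (Leb d)" for x
      unfolding B'_def by (rule test_set_dominates[OF \<eta>0 \<eta>(2) k0 that])
  qed (use fit0 fit \<tau> \<tau>0(1) int[OF dens] in \<open>auto simp: fits_frequencies_def B_def B'_def\<close>)
  also have "4 * (2 * real k * \<eta>) = \<epsilon> / 2" using k by (simp add: \<eta>(1))
  finally have d1: "(\<integral>x. \<bar>expmix d k \<tau>0 x - expmix d k \<tau> x\<bar> \<partial>Leb d) \<le> 4 * D + 6 * \<alpha> + \<epsilon> / 2" by simp
  note it = int(1)[OF dens[OF \<tau>]] and it0 = int(1)[OF dens[OF \<tau>0(1)]]
  have "(\<integral>x. \<bar>expmix d k \<tau> x - g x\<bar> \<partial>Leb d)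
      \<le> (\<integral>x. \<bar>expmix d k \<tau>0 x - expmix d k \<tau> x\<bar> + \<bar>expmix d k \<tau>0 x - g x\<bar> \<partial>Leb d)"
    using it it0 ig by (intro integral_mono) auto
  also have "\<dots> = (\<integral>x. \<bar>expmix d k \<tau>0 x - expmix d k \<tau> x\<bar> \<partial>Leb d) + D"
    unfolding D_def using it it0 ig by (intro Bochner_Integration.integral_add) auto
  also have "\<dots> \<le> 5 * (o' + \<alpha>) + 6 * \<alpha> + \<epsilon> / 2" 
  proof -
    have "u + D \<le> 5 * (o' + \<alpha>) + 6 * \<alpha> + \<epsilon> / 2" if "u \<le> 4 * D + 6 * \<alpha> + \<epsilon> / 2" for u
      using that \<tau>0(2)[folded D_def] by argo
    then show ?thesis using d1 .
  qed
  \<comment> \<open>The eleven copies of \<alpha> = \<epsilon> / 22 add up to \<epsilon> /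
    2.\<close>
  also have "\<dots> \<le> 9 * o' + \<epsilon>" using o'(2) by (simp add: \<alpha>_def)
  finally have "ennreal (\<integral>x. \<bar>expmix d k \<tau> x - g x\<bar> \<partial>Leb d) \<le> ennreal (9 * o' + \<epsilon>)" by (rule ennreal_leI)
  also have "\<dots> = 9 * ennreal o' + ennreal \<epsilon>"
    using o'(2) \<epsilon> by (simp add: ennreal_plus ennreal_mult')
  finally show ?thesis
    unfolding \<tau>_def[symmetric] \<alpha>_def[symmetric] o'(1) L1dist_eq_integral[OF it ig] .
qed

section \<open>The agnostic and the realizable guarantee for one learner\<close>

theorem theorem7:
  "\<exists>C>0. \<exists>A :: nat \<Rightarrow> nat \<Rightarrow> real \<Rightarrow> real \<Rightarrow> (nat \<Rightarrow> (nat \<Rightarrow> real)) \<Rightarrow> ((nat \<Rightarrow> real) \<Rightarrow> real).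
     (\<forall>d k \<epsilon> \<delta> g. d \<ge> 1 \<longrightarrow> k \<ge> 1 \<longrightarrow> \<epsilon> > 0 \<longrightarrow> \<delta> > 0 \<longrightarrow> is_density d g \<longrightarrow>
        (let m = sample_size C d k \<epsilon> \<delta> in
         \<exists>E\<in>sets (sample_space d m g). measure (sample_space d m g) E \<ge> 1 - \<delta> \<and>
           (\<forall>S\<in>E. A d k \<epsilon> \<delta> S \<in> borel_measurable (Leb d) \<and>
              L1dist d (A d k \<epsilon> \<delta> S) g \<le> 9 * opt d (mixtures d k) g + ennreal \<epsilon>)))
   \<and> (\<forall>d k \<epsilon> \<delta> g. d \<ge> 1 \<longrightarrow> k \<ge> 1 \<longrightarrow> \<epsilon> > 0 \<longrightarrow> \<delta> > 0 \<longrightarrow> g \<in> mixtures d k \<longrightarrow>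
        (let m = sample_size C d k \<epsilon> \<delta> in
         \<exists>E\<in>sets (sample_space d m g). measure (sample_space d m g) E \<ge> 1 - \<delta> \<and>
           (\<forall>S\<in>E. A d k \<epsilon> \<delta> S \<in> borel_measurable (Leb d) \<and>
              L1dist d (A d k \<epsilon> \<delta> S) g \<le> ennreal \<epsilon>)))"
proof -
  have "\<exists>T. countable T \<and> (\<forall>\<tau>\<in>T. expmix d k \<tau> \<in> mixtures d k) \<and>
    (\<forall>f\<in>mixtures d k. \<forall>\<eta>>0. \<exists>\<tau>\<in>T. L1dist d (expmix d k \<tau>) f \<le> ennreal \<eta>)" for d k
    by (rule countable_dense_expmix[of d k]) blast
  \<comment> \<open>The candidates are fixed as a function of d and k before g is given, so the
    learner does not depend on g.\<close>
  then obtain T where T: "\<And>d k. countable (T d k)" "\<And>d k \<tau>. \<tau> \<in> T d k \<Longrightarrow> expmix d k \<tau> \<in> mixtures d k"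
    "\<And>d k f \<eta>. f \<in> mixtures d k \<Longrightarrow> \<eta> > 0 \<Longrightarrow> \<exists>\<tau>\<in>T d k. L1dist d (expmix d k \<tau>) f \<le> ennreal \<eta>"
    by metis
  define C :: real where "C = 10 ^ 7"
  define e where "e = (\<lambda>(k :: nat) \<epsilon> :: real. \<epsilon> / (16 * real k))"
  define L where "L = (\<lambda>k \<epsilon>. nat \<lceil>1 / (e k \<epsilon>)\<^sup>2\<rceil>)"
  \<comment> \<open>For \<epsilon> >= 2 any fixed candidate will do, since two densities are at
    distance at most 2.\<close>
  define A where "A = (\<lambda>d k \<epsilon> \<delta> S. if \<epsilon> \<ge> 2 then expmix d k (SOME \<tau>. \<tau> \<in> T d k)
    else expmix d k (min_distance_choice d k (L k \<epsilon>) (e k \<epsilon>) (T d k) S (sample_size C d k \<epsilon> \<delta>) (\<epsilon> / 22)))"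
  have meas: "A d k \<epsilon> \<delta> S \<in> borel_measurable (Leb d)" for d k \<epsilon> \<delta> S by (simp add: A_def)
  have main: "\<exists>E\<in>sets (sample_space d m g). measure (sample_space d m g) E \<ge> 1 - \<delta> \<and>
      (\<forall>S\<in>E. L1dist d (A d k \<epsilon> \<delta> S) g \<le> 9 * opt d (mixtures d k) g + ennreal \<epsilon>)"
    if dk: "d \<ge> 1" "k \<ge> 1" and \<epsilon>: "\<epsilon> > 0" and \<delta>: "\<delta> > 0" and g: "is_density d g" and m: "m = sample_size C d k \<epsilon> \<delta>"
    for d k \<epsilon> \<delta> g m
  proof -
    interpret P: prob_space "density (Leb d) (\<lambda>x. ennreal (g x))" by (rule prob_space_density_Leb[OF g])
    interpret N: prob_space "sample_space d m g"
      unfolding sample_space_def by (intro prob_space_PiM P.prob_space_axioms)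
    consider "\<delta> \<ge> 1" | "\<epsilon> \<ge> 2" | "\<delta> < 1" "\<epsilon> < 2" by linarith
    then show ?thesis
    proof cases
      \<comment> \<open>Now 1 - \<delta> is at most 0 and the empty event suffices, even where the
        prescribed sample size is 0.\<close>
      case 1
      then show ?thesis by (intro bexI[of _ "{}"]) auto
    next
      case 2
      have "T d k \<noteq> {}" using mixtures_nonempty[OF dk(2), of d] T(3)[of _ d k 1] by fastforce
      then have "(SOME \<tau>. \<tau> \<in> T d k) \<in> T d k" by (simp add: some_in_eq)
      then have "is_density d (A d k \<epsilon> \<delta> S)" for S
        using mixtures_density(1)[OF T(2)] 2 by (simp add: A_def)
      then have "L1dist d (A d k \<epsilon> \<delta> S) g \<le> 9 * opt d (mixtures d k) g + ennreal \<epsilon>" for S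
      proof -
        have "L1dist d (A d k \<epsilon> \<delta> S) g \<le> ennreal 2"
          using L1dist_density_le_2[OF \<open>is_density d (A d k \<epsilon> \<delta> S)\<close> g] by simp
        also have "\<dots> \<le> ennreal \<epsilon>" using 2 by (rule ennreal_leI)
        also have "\<dots> \<le> 9 * opt d (mixtures d k) g + ennreal \<epsilon>" by simp
        finally show ?thesis .
      qed
      then show ?thesis using \<delta> N.prob_space by (intro bexI[of _ "space (sample_space d m g)"]) auto
    next
      case 3
      have "real m \<ge> 10 ^ 7 * real k * real d ^ 2 * (1 + ln (real k)) * (1 + ln (real k / \<delta>)) / \<epsilon> ^ 4"
        unfolding m sample_size_def C_def by (rule real_nat_ceiling_ge)
      note n = this
      obtain E where E: "E \<in> sets (sample_space d m g)" "measure (sample_space d m g) E \<ge> 1 - \<delta>"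
        "\<And>S \<psi>. S \<in> E \<Longrightarrow> \<psi> \<in> (\<lambda>(\<sigma>, \<sigma>'). join_params k \<sigma> \<sigma>') ` (T d k \<times> T d k) \<Longrightarrow>
          \<bar>(\<integral>x. g x * indicator (test_set d k (L k \<epsilon>) (e k \<epsilon>) \<psi>) x \<partial>Leb d)
          - (\<Sum>i<m. indicator (test_set d k (L k \<epsilon>) (e k \<epsilon>) \<psi>) (S i)) / m\<bar> \<le> \<epsilon> / 22"
        \<comment> \<open>Test sets are indexed by ordered pairs of candidates, again a countable
          family.\<close>
        using uniform_frequency_event[OF dk(2,1) \<epsilon> 3(2) \<delta> 3(1) n g, of "(\<lambda>(\<sigma>, \<sigma>'). join_params k \<sigma> \<sigma>') ` (T d k \<times> T d k)"]
          T(1)[of d k] unfolding L_def e_def by blast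
      have "L1dist d (A d k \<epsilon> \<delta> S) g \<le> 9 * opt d (mixtures d k) g + ennreal \<epsilon>" if S: "S \<in> E" for S
      proof -
        have "L1dist d (expmix d k (min_distance_choice d k (L k \<epsilon>) (e k \<epsilon>) (T d k) S m (\<epsilon> / 22))) g
            \<le> 9 * opt d (mixtures d k) g + ennreal \<epsilon>"
        proof (rule min_distance_agnostic[OF dk(2) \<epsilon> g T(2) T(3)])
          show "exp (- (real (L k \<epsilon>) * e k \<epsilon>)) \<le> e k \<epsilon>"
            using sample_size_sufficient(2)[OF dk(2,1) \<epsilon> 3(2) \<delta> 3(1) n] by (simp add: L_def e_def)
        qed (use E(3)[OF S] in \<open>auto simp: e_def\<close>)
        then show ?thesis using 3 by (simp add: A_def m)
      qed
      then show ?thesis using E by blast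
    qed
  qed
  have "L1dist d (A d k \<epsilon> \<delta> S) g \<le> ennreal \<epsilon>"
    if "g \<in> mixtures d k" "L1dist d (A d k \<epsilon> \<delta> S) g \<le> 9 * opt d (mixtures d k) g + ennreal \<epsilon>" for d k \<epsilon> \<delta> S g
  proof -
    \<comment> \<open>A target inside the class is its own approximation at distance 0, so the
      agnostic bound reduces to \<epsilon>.\<close>
    have "opt d (mixtures d k) g \<le> L1dist d g g" unfolding opt_def using that(1) by (rule INF_lower)
    then have "opt d (mixtures d k) g = 0" by (simp add: L1dist_def)
    then show ?thesis using that(2) by simp
  qed
  note realizable = this
  show ?thesis
  proof (intro exI[of _ C] exI[of _ A] conjI allI impI, goal_cases)
    case 1
    show ?case by (simp add: C_def)
  next
    case (2 d k \<epsilon> \<delta> g)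
    then show ?case using main[OF 2 refl] meas unfolding Let_def by blast
  next
    case (3 d k \<epsilon> \<delta> g)
    show ?case using main[OF 3(1-4) mixtures_density(1)[OF 3(5)] refl] realizable[OF 3(5)] meas unfolding Let_def by blast
  qed
qed

end
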